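(* For all integers $k,\ell$ with $\ell\ge 1$ and $k\ge 2\ell+3$ there exist $n_0=n_0(k)$ and a constant $C=C(k)$, both depending only on $k$, such that the following holds for every integer $n\ge n_0$ and every real $\epsilon$ with $0\le \epsilon<1$ (where $\epsilon=\epsilon(n)$ is allowed to depend on $n$). If $\mathcal F\subset \binom{[n]}{k}$ avoids intersection $\ell$ and $$|\mathcal F|\ge (1-\epsilon)\binom{n-\ell-1}{k-\ell-1},$$ then there is a set $X\subset [n]$ with $|X|=\ell+1$ such that $$|\mathcal F\setminus \mathcal F[X]|\le \Big(\frac{\ell\epsilon}{(1-\epsilon)(k-2\ell-1)}\Big)^{\frac{k-\ell-1}{\ell}}\binom{n-\ell-1}{k-\ell-1}+C\, n^{k-\ell-2}.$$
   Context: Here $[n]=\{1,\ldots,n\}$ and $\binom{[n]}{k}$ is the collection of all $k$-element subsets of $[n]$. A family $\mathcal F\subset\binom{[n]}{k}$ avoids intersection $\ell$ if $|A\cap B|\ne \ell$ for all $A,B\in\mathcal F$. For a set $X$, $\mathcal F[X]=\{A\in\mathcal F: X\subset A\}$. *)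

theory Defs
  imports Complex_Main "HOL-Library.Ramsey"
begin

definition avoids_intersection :: "nat \<Rightarrow> 'a set set \<Rightarrow> bool" where
  "avoids_intersection l F \<longleftrightarrow> (\<forall>A\<in>F. \<forall>B\<in>F. card (A \<inter> B) \<noteq> l)"

definition subfamily_containing :: "'a set set \<Rightarrow> 'a set \<Rightarrow> 'a set set" where
  "subfamily_containing F X = {A \<in> F. X \<subseteq> A}"

end

theory Submission
  imports Defs "HOL-Library.FuncSet"
begin

text \<open>
  The proof is a delta-system argument in the style of Frankl and Furedi. All but
  \<open>O(n^(k-l-2))\<close> members \<open>A\<close> of \<open>F\<close> have a root: an \<open>(l+1)\<close>-set \<open>X \<subseteq> A\<close> such that every \<open>Z\<close> with
  \<open>X \<subseteq> Z \<subset> A\<close> is the kernel of a sunflower in \<open>F\<close> with \<open>k+1\<close> petals. Any two such kernels are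
  realised as \<open>Z \<inter> Z' = A \<inter> B\<close> with \<open>A, B \<in> F\<close>, so \<open>card (Z \<inter> Z') \<noteq> l\<close>; hence the \<open>l\<close>-shadows of
  the families \<open>G X = {A - X | A has root X}\<close> are disjoint for distinct \<open>X\<close>. With \<open>r = k - l - 1\<close>
  and \<open>h X = r! card (G X) / n^r\<close>, a Loomis-Whitney bound on shadows gives \<open>\<Sum>(h X)^(l/r) \<le> 1\<close>,
  while \<open>\<Sum>h X \<ge> 1 - \<epsilon> - O(1/n)\<close>. By concavity of the power one \<open>h X\<close> is then nearly \<open>1\<close>, and
  the remaining ones sum to at most the claimed amount.
\<close>

subsection \<open>Set systems whose unions avoid one size\<close>

text \<open>Kernel structure is only available inside homogeneous subfamilies, while nearly all of
  \<open>F\<close> has to be controlled. So homogeneity is applied to the rootless members alone: a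
  proportion depending only on \<open>k\<close> survives, and there the colour types of kernels form
  an intersection-closed system with no type of size \<open>l\<close>. Either some
  \<open>l + 1\<close> colours have every superset except the full set as a type, which yields a
  root and a contradiction, or some \<open>l + 2\<close> colours contain no complement of a type,
  and then each surviving member is determined by its \<open>k - l - 2\<close> points of the other
  colours. That nothing lies in between is a statement about union-closed systems, and
  \<open>2 * l + 3 \<le> k\<close> makes room for it. The constants of the bound come from
  \<open>p = l / r\<close>. If the p-th powers of the h X sum to at most 1 and the h X sum to
  \<sigma>, then the largest one has p-th power at least \<sigma>^s with s = p / (1 - p) = l / (k -
  2l - 1), and the others sum to at most (1 - \<sigma>^s)^(1/p), which is at most (s\<epsilon> / (1
  - \<epsilon>))^(1/p) up to O(1/n).\<close>

text \<open>Taking x into \<open>T\<close> and passing to the traces on \<open>Q - B x\<close> costs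
  one unit of s: x itself counts one, and \<open>B x\<close> counts what \<open>Q\<close> loses.
  This works down to s = 1, where a point y of \<open>Q\<close> outside \<open>B x\<close> has to be
  deleted as well in order to keep s positive. Only the members missing y then remain, which is
  affordable if \<open>d y \<le> b x\<close>; Motzkin's argument shows that such a pair
  exists.\<close>

lemma frankl_katona:
  fixes B :: "'a \<Rightarrow> 'b set"
  assumes "finite X" "finite Q" "\<And>x. x \<in> X \<Longrightarrow> B x \<subseteq> Q"
    and "card Q + s \<le> card X" "1 \<le> s"
  shows "\<exists>T\<subseteq>X. card T + card (\<Union>x\<in>T. B x) = card Q + s"
  using assms
proof (induction "card Q" arbitrary: X Q B s rule: less_induct)
  case (less Q X0 B s)
  obtain X where X: "X \<subseteq> X0" and cardX: "card X = card Q + s"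
    using less.prems(4) by (meson obtain_subset_with_card_n)
  have finX: "finite X" and finQ: "finite Q" and BQ: "\<And>x. x \<in> X \<Longrightarrow> B x \<subseteq> Q"
    using less.prems X by (auto intro: finite_subset)
  consider (empty) "\<forall>x\<in>X. B x = {}" | (two) x where "x \<in> X" "B x \<noteq> {}" "2 \<le> s"
    | (full) x where "x \<in> X" "B x = Q" "s = 1" | (one) "s = 1" "\<forall>x\<in>X. B x \<noteq> Q"
    using less.prems(5) by (cases "s = 1") force+
  then have "\<exists>T\<subseteq>X. card T + card (\<Union>x\<in>T. B x) = card Q + s"
  proof cases
    case empty
    obtain T where T: "T \<subseteq> X" "card T = card Q + s"
      using cardX by (meson obtain_subset_with_card_n order_refl)
    then have "(\<Union>x\<in>T. B x) = {}" using empty by auto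
    then show ?thesis using T by (intro exI[of _ T]) simp
  next
    case two
    have finB: "finite (B x)" using BQ[OF two(1)] finQ by (rule finite_subset)
    then have B0: "0 < card (B x)" using two by (simp add: card_gt_0_iff)
    have cQ: "card (Q - B x) = card Q - card (B x)" "card (B x) \<le> card Q"
      using two BQ finB finQ by (auto simp: card_Diff_subset card_mono)
    have "\<exists>T\<subseteq>X - {x}. card T + card (\<Union>y\<in>T. B y - B x) = card (Q - B x) + (s - 1)"
    proof (rule less.hyps)
      show "card (Q - B x) < card Q" using cQ B0 by linarith
      show "card (Q - B x) + (s - 1) \<le> card (X - {x})"
        using two cardX finX B0 cQ by (simp add: card_Diff_singleton)
    qed (use finX finQ BQ two in auto)
    then obtain T where T: "T \<subseteq> X - {x}"
      "card T + card (\<Union>y\<in>T. B y - B x) = card (Q - B x) + (s - 1)" by blast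
    have finT: "finite T" using T(1) finX by (auto intro: finite_subset)
    have "finite (\<Union>y\<in>T. B y - B x)" using finT T(1) BQ finQ by (blast intro: finite_subset)
    moreover have "(\<Union>y\<in>insert x T. B y) = B x \<union> (\<Union>y\<in>T. B y - B x)" by auto
    ultimately have "card (\<Union>y\<in>insert x T. B y) = card (B x) + card (\<Union>y\<in>T. B y - B x)"
      using card_Un_disjoint[OF finB] by (metis (no_types, lifting) Diff_disjoint Int_UN_distrib SUP_bot_conv(2))
    moreover have "card (insert x T) = Suc (card T)" using T(1) finT by (intro card_insert_disjoint) blast+
    ultimately have "card (insert x T) + card (\<Union>y\<in>insert x T. B y) = card Q + s"
      using T(2) cQ two(3) by linarith
    moreover have "insert x T \<subseteq> X" using T(1) two(1) by auto
    ultimately show ?thesis by blast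
  next
    case full
    then show ?thesis by (intro exI[of _ "{x}"]) auto
  next
    case one
    define b where "b x = card (B x)" for x
    define d where "d y = card {x \<in> X. y \<in> B x}" for y
    have finB: "finite (B x)" if "x \<in> X" for x using BQ[OF that] finQ by (rule finite_subset)
    have bQ: "b x < card Q" if "x \<in> X" for x
      unfolding b_def using that one BQ finQ by (simp add: psubset_card_mono psubsetI)
    show ?thesis
    proof (cases "\<exists>x\<in>X. \<exists>y\<in>Q - B x. d y \<le> b x")
      case True
      then obtain x y where xy: "x \<in> X" "y \<in> Q" "y \<notin> B x" "d y \<le> b x" by auto
      \<comment> \<open>The deletion of y lowers the target by one, so s stays 1. The hypothesis
        survives because \<open>card X' = card Q - d y\<close> is at least
        \<open>card Q - b x = card Q' + 1\<close>.\<close>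
      define X' where "X' = {z \<in> X. y \<notin> B z} - {x}"
      define Q' where "Q' = Q - insert y (B x)"
      have fi: "finite (insert y (B x))" "card (insert y (B x)) = Suc (b x)"
        using finB[OF xy(1)] xy by (auto simp: b_def)
      have sub: "insert y (B x) \<subseteq> Q" using xy BQ by auto
      have cQ': "card Q' = card Q - Suc (b x)" unfolding Q'_def using card_Diff_subset[OF fi(1) sub] fi by simp
      have "card {z \<in> X. y \<notin> B z} = card X - d y"
      proof -
        have "{z \<in> X. y \<notin> B z} = X - {z \<in> X. y \<in> B z}" by auto
        then show ?thesis unfolding d_def using finX by (simp add: card_Diff_subset)
      qed
      then have cX': "card X' = card X - d y - 1" unfolding X'_def using xy finX by simp
      have "\<exists>T\<subseteq>X'. card T + card (\<Union>z\<in>T. B z - B x) = card Q' + 1"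
      proof (rule less.hyps)
        show "card Q' < card Q" using cQ' bQ[OF xy(1)] by linarith
        show "B z - B x \<subseteq> Q'" if "z \<in> X'" for z using that BQ unfolding X'_def Q'_def by auto
        show "card Q' + 1 \<le> card X'" using cX' cQ' xy(4) cardX one bQ[OF xy(1)] by linarith
      qed (use finX finQ in \<open>auto simp: X'_def Q'_def\<close>)
      then obtain T where T: "T \<subseteq> X'" "card T + card (\<Union>z\<in>T. B z - B x) = card Q' + 1" by blast
      have TX: "T \<subseteq> X" "x \<notin> T" and finT: "finite T"
        using T(1) finX by (auto simp: X'_def intro: finite_subset)
      have "finite (\<Union>y\<in>T. B y - B x)" using finT TX finB by auto
      moreover have "(\<Union>y\<in>insert x T. B y) = B x \<union> (\<Union>y\<in>T. B y - B x)" by auto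
      ultimately have "card (\<Union>y\<in>insert x T. B y) = b x + card (\<Union>y\<in>T. B y - B x)"
          using card_Un_disjoint[OF finB[OF xy(1)]] unfolding b_def
        by (metis (no_types, lifting) Diff_disjoint Int_UN_distrib SUP_bot_conv(2))
      moreover have "card (insert x T) = Suc (card T)" using TX finT by auto
      ultimately have "card (insert x T) + card (\<Union>y\<in>insert x T. B y) = card Q + s"
        using T(2) cQ' one(1) bQ[OF xy(1)] by linarith
      moreover have "insert x T \<subseteq> X" using TX xy(1) by auto
      ultimately show ?thesis by blast
    next
      case False
      define n where "n = card Q"
      define m where "m = card X"
      have mn: "m = n + 1" using cardX one by (simp add: n_def m_def)
      have dm: "d y \<le> m" for y unfolding d_def m_def using finX by (intro card_mono) auto
      have cx: "card {y \<in> Q. y \<notin> B x} = n - b x" if "x \<in> X" for x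
      proof -
        have "{y \<in> Q. y \<notin> B x} = Q - B x" by auto
        then show ?thesis using finB[OF that] BQ[OF that] by (simp add: n_def b_def card_Diff_subset)
      qed
      have cy: "card {x \<in> X. y \<notin> B x} = m - d y" for y
      proof -
        have "{z \<in> X. y \<notin> B z} = X - {z \<in> X. y \<in> B z}" by auto
        then show ?thesis unfolding d_def m_def using finX by (simp add: card_Diff_subset)
      qed
      text \<open>Motzkin's double counting over the non-incident pairs: all of them satisfy \<open>b x < d y\<close>.\<close>
      have "real m = (\<Sum>x\<in>X. \<Sum>y\<in>{y \<in> Q. y \<notin> B x}. 1 / real (n - b x))"
      proof -
        have "(\<Sum>y\<in>{y \<in> Q. y \<notin> B x}. 1 / real (n - b x)) = 1" if "x \<in> X" for x
          using bQ[OF that] by (simp add: cx[OF that] n_def)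
        then have "(\<Sum>x\<in>X. \<Sum>y\<in>{y \<in> Q. y \<notin> B x}. 1 / real (n - b x)) = (\<Sum>x\<in>X. 1)"
          by (intro sum.cong refl)
        then show ?thesis by (simp only: m_def real_of_card)
      qed
      also have "\<dots> \<le> (\<Sum>x\<in>X. \<Sum>y\<in>{y \<in> Q. y \<notin> B x}. 1 / real (m - d y))"
      proof (intro sum_mono)
        fix x y assume *: "x \<in> X" "y \<in> {y \<in> Q. y \<notin> B x}"
        then have "b x < d y" using False by force
        moreover have "d y < m"
        proof -
          have "{z \<in> X. y \<in> B z} \<subset> X" using * by auto
          then show ?thesis unfolding d_def m_def using finX by (rule psubset_card_mono[rotated])
        qed
        \<comment> \<open>As m = n + 1, the strict inequality \<open>b x < d y\<close> gives
          \<open>m - d y \<le> n - b x\<close>.\<close>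
        ultimately show "1 / real (n - b x) \<le> 1 / real (m - d y)"
          using mn by (intro divide_left_mono) auto
      qed
      also have "\<dots> = (\<Sum>y\<in>Q. \<Sum>x\<in>{x \<in> X. y \<notin> B x}. 1 / real (m - d y))"
        by (rule sum.swap_restrict) (use finX finQ in auto)
      \<comment> \<open>The inner sum is 1, or empty when y lies in every \<open>B x\<close>. The
        outcome m \<le> n contradicts m = n + 1.\<close>
      also have "\<dots> \<le> (\<Sum>y\<in>Q. 1)"
        by (intro sum_mono) (simp add: cy)
      finally show ?thesis using mn by (simp add: n_def)
    qed
  qed
  then show ?case using X by blast
qed

text \<open>Let \<open>Q\<close> be a largest set without nonempty members of \<open>N\<close>. By
  maximality each x outside it has a member \<open>M x\<close> consisting of x and a subset
  \<open>B x\<close> of \<open>Q\<close>. The union of \<open>M x\<close> over \<open>T\<close> has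
  size \<open>card T + card (\<Union>x\<in>T. B x)\<close>, and \<open>frankl_katona\<close> reaches
  the forbidden size \<open>k - l\<close> unless \<open>card Q = l + 1\<close> and all
  \<open>B x\<close> are empty. In the application \<open>K\<close> is the set of colours and
  \<open>N\<close> holds the complements of kernel types.\<close>

lemma union_closed_many_singletons:
  fixes K :: "'a set"
  assumes K: "finite K" "card K = k" "2 * l + 3 \<le> k"
    and sub: "\<And>M. M \<in> N \<Longrightarrow> M \<subseteq> K"
    and un: "\<And>M M'. M \<in> N \<Longrightarrow> M' \<in> N \<Longrightarrow> M \<union> M' \<in> N"
    and dense: "\<And>D. D \<subseteq> K \<Longrightarrow> card D = l + 2 \<Longrightarrow> \<exists>M\<in>N. M \<noteq> {} \<and> M \<subseteq> D"
    and size: "\<And>M. M \<in> N \<Longrightarrow> card M \<noteq> k - l"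
  shows "\<exists>Y\<subseteq>K. card Y = k - l - 1 \<and> (\<forall>y\<in>Y. {y} \<in> N)"
proof -
  define free where "free Q \<longleftrightarrow> Q \<subseteq> K \<and> (\<forall>M\<in>N. M \<subseteq> Q \<longrightarrow> M = {})" for Q
  have "\<exists>Q. free Q \<and> (\<forall>Q'. free Q' \<longrightarrow> card Q' \<le> card Q)"
  proof (rule ex_has_greatest_nat[where k = "{}" and b = "k + 1"])
    show "free {}" unfolding free_def by auto
    show "\<forall>Q. free Q \<longrightarrow> card Q < k + 1" unfolding free_def using K by (auto simp: less_Suc_eq_le intro: card_mono)
  qed
  then obtain Q where Q: "free Q" and maxQ: "\<And>Q'. free Q' \<Longrightarrow> card Q' \<le> card Q" by blast
  have QK: "Q \<subseteq> K" and finQ: "finite Q" using Q K unfolding free_def by (auto intro: finite_subset)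
  have cQ: "card Q \<le> l + 1"
  proof (rule ccontr)
    assume "\<not> card Q \<le> l + 1"
    then obtain D where D: "D \<subseteq> Q" "card D = l + 2"
      by (metis Suc_eq_plus1 add_2_eq_Suc' not_less_eq_eq obtain_subset_with_card_n)
    then show False using dense[of D] Q QK unfolding free_def by blast
  qed
  define P where "P = K - Q"
  have finP: "finite P" and cP: "card P = k - card Q"
    using K QK finQ by (auto simp: P_def card_Diff_subset)
  have "\<exists>M\<in>N. x \<in> M \<and> M \<subseteq> insert x Q" if "x \<in> P" for x
  proof -
    have "\<not> free (insert x Q)" using maxQ[of "insert x Q"] that finQ by (auto simp: P_def)
    moreover have "insert x Q \<subseteq> K" using that QK by (auto simp: P_def)
    ultimately obtain M where "M \<in> N" "M \<subseteq> insert x Q" "M \<noteq> {}"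
      unfolding free_def by blast
    moreover have "x \<in> M" using calculation Q unfolding free_def by blast
    ultimately show ?thesis by blast
  qed
  then obtain M where M: "\<And>x. x \<in> P \<Longrightarrow> M x \<in> N" "\<And>x. x \<in> P \<Longrightarrow> x \<in> M x"
    "\<And>x. x \<in> P \<Longrightarrow> M x \<subseteq> insert x Q" by metis
  define B where "B x = M x \<inter> Q" for x
  have UnN: "(\<Union>x\<in>T. M x) \<in> N" if "T \<subseteq> P" "T \<noteq> {}" for T
  proof -
    have "finite T" using that finP finite_subset by blast
    then show ?thesis using that(2,1) by (induction T rule: finite_ne_induct) (auto intro: un M)
  qed
  have no: "card T + card (\<Union>x\<in>T. B x) \<noteq> k - l" if T: "T \<subseteq> P" for T
  proof (cases "T = {}")
    case True
    then show ?thesis using K by auto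
  next
    case False
    have "finite T" using T finP finite_subset by blast
    moreover have "(\<Union>x\<in>T. M x) = T \<union> (\<Union>x\<in>T. B x)"
      unfolding B_def using T M(2,3) by blast
    moreover have "T \<inter> (\<Union>x\<in>T. B x) = {}" unfolding B_def using T P_def by blast
    moreover have "finite (\<Union>x\<in>T. B x)" unfolding B_def using finQ by (auto intro: finite_subset[OF _ finQ])
    ultimately show ?thesis using size[OF UnN[OF T False]] by (simp add: card_Un_disjoint)
  qed
  have "\<not> card Q \<le> l"
  proof
    assume "card Q \<le> l"
    then have "\<exists>T\<subseteq>P. card T + card (\<Union>x\<in>T. B x) = card Q + (k - l - card Q)"
      using K cP by (intro frankl_katona finP finQ) (auto simp: B_def)
    then show False using no \<open>card Q \<le> l\<close> K by auto
  qed
  then have cQ: "card Q = l + 1" using cQ by simp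
  have "B x = {}" if x: "x \<in> P" for x
  proof (rule ccontr)
    assume ne: "B x \<noteq> {}"
    have finB: "finite (B x)" and BQ: "B x \<subseteq> Q" using finQ by (auto simp: B_def)
    have B0: "0 < card (B x)" using ne finB by (simp add: card_gt_0_iff)
    have cB: "card (B x) \<le> card Q" "card (Q - B x) = card Q - card (B x)"
      using BQ finQ finB by (auto simp: card_mono card_Diff_subset)
    \<comment> \<open>Now \<open>Q\<close> is too large for a direct use, so x is put into
      \<open>T\<close> by hand and only \<open>Q - B x\<close> remains. The slack
      \<open>k - 2 * l - 2\<close> makes the final total \<open>k - l\<close>; it is positive
      because \<open>2 * l + 3 \<le> k\<close>.\<close>
    have "\<exists>T\<subseteq>P - {x}. card T + card (\<Union>y\<in>T. B y - B x) = card (Q - B x) + (k - 2 * l - 2)"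
    proof (rule frankl_katona)
      show "card (Q - B x) + (k - 2 * l - 2) \<le> card (P - {x})"
        using cB B0 cQ cP K finP x by (simp add: card_Diff_singleton)
    qed (use finP finQ K in \<open>auto simp: B_def\<close>)
    then obtain T where T: "T \<subseteq> P - {x}"
      "card T + card (\<Union>y\<in>T. B y - B x) = card (Q - B x) + (k - 2 * l - 2)" by blast
    have finT: "finite T" using T(1) finP by (auto intro: finite_subset)
    have "(\<Union>y\<in>insert x T. B y) = B x \<union> (\<Union>y\<in>T. B y - B x)" by auto
    then have "card (\<Union>y\<in>insert x T. B y) = card (B x) + card (\<Union>y\<in>T. B y - B x)"
      using card_Un_disjoint[OF finB, of "\<Union>y\<in>T. B y - B x"] finQ finT
      by (metis (no_types, lifting) B_def Diff_disjoint Int_UN_distrib SUP_bot_conv(2) finite_Diff finite_Int finite_UN_I)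
    moreover have "card (insert x T) = Suc (card T)" using T(1) finT by (intro card_insert_disjoint) blast+
    ultimately have "card (insert x T) + card (\<Union>y\<in>insert x T. B y) = k - l"
      using T(2) cB cQ K by linarith
    then show False using no[of "insert x T"] T(1) x by blast
  qed
  then have "M x = {x}" if "x \<in> P" for x using M(2,3)[OF that] that unfolding B_def by blast
  then have "\<forall>y\<in>P. {y} \<in> N" using M(1) by force
  moreover have "P \<subseteq> K" "card P = k - l - 1" using cP cQ by (auto simp: P_def)
  ultimately show ?thesis by blast
qed

subsection \<open>Sunflower kernels and homogeneous subfamilies\<close>

text \<open>The strict inclusion keeps petals nonempty. Hence for positive s the kernels in a family
  of k-sets have fewer than k points, which is why roots only speak of proper subsets of a
  member.\<close>

definition kernel :: "nat \<Rightarrow> 'a set set \<Rightarrow> 'a set \<Rightarrow> bool" where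
  "kernel s F K \<longleftrightarrow> (\<exists>P\<subseteq>F. finite P \<and> s \<le> card P \<and> (\<forall>A\<in>P. K \<subset> A) \<and>
     (\<forall>A\<in>P. \<forall>B\<in>P. A \<noteq> B \<longrightarrow> A \<inter> B = K))"

lemma kernel_mono: "kernel s F K \<Longrightarrow> F \<subseteq> G \<Longrightarrow> kernel s G K"
  unfolding kernel_def by (elim ex_forward conj_forward subset_trans) auto

text \<open>Each point outside \<open>K\<close> lies in at most one petal.\<close>
lemma kernel_avoids:
  assumes "kernel s F K" "finite S" "card S < s"
  shows "\<exists>A\<in>F. K \<subset> A \<and> (A - K) \<inter> S = {}"
proof (rule ccontr)
  from assms(1) obtain P where P: "P \<subseteq> F" "finite P" "s \<le> card P" "\<forall>A\<in>P. K \<subset> A"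
    and PK: "\<forall>A\<in>P. \<forall>B\<in>P. A \<noteq> B \<longrightarrow> A \<inter> B = K"
    unfolding kernel_def by (elim exE conjE)
  assume neg: "\<not> ?thesis"
  have ex: "\<exists>x. x \<in> S \<and> x \<in> A \<and> x \<notin> K" if "A \<in> P" for A
  proof -
    have "A \<in> F" "K \<subset> A" using that P by auto
    then have "(A - K) \<inter> S \<noteq> {}" using neg by metis
    then show ?thesis by auto
  qed
  obtain f where f: "\<And>A. A \<in> P \<Longrightarrow> f A \<in> S \<and> f A \<in> A \<and> f A \<notin> K"
    using ex by metis
  have "inj_on f P"
  proof (rule inj_onI)
    fix A B assume "A \<in> P" "B \<in> P" "f A = f B"
    moreover from this have "f A \<in> A \<inter> B - K" using f[of A] f[of B] by simp
    ultimately show "A = B" using PK by blast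
  qed
  then have "card P \<le> card S" using f assms(2) by (intro card_inj_on_le) auto
  then show False using P(3) assms(3) by linarith
qed

text \<open>First A is chosen around \<open>K1\<close> so that its petal misses \<open>K2\<close>,
  then B around \<open>K2\<close> so that its petal misses all of A. Either time at most k points
  have to be avoided, hence the k + 1 petals.\<close>

lemma kernels_inter:
  assumes F: "\<And>A. A \<in> F \<Longrightarrow> finite A \<and> card A = k"
    and "kernel (k + 1) F K1" "kernel (k + 1) F K2"
  shows "\<exists>A\<in>F. \<exists>B\<in>F. K1 \<subseteq> A \<and> K2 \<subseteq> B \<and> A \<inter> B = K1 \<inter> K2"
proof -
  obtain B0 where "B0 \<in> F" "K2 \<subset> B0" using kernel_avoids[OF assms(3), of "{}"] by auto
  then have "finite K2" "card K2 < k + 1"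
    using F[of B0] psubset_card_mono[of B0 K2] by (auto intro: finite_subset)
  then obtain A where A: "A \<in> F" "K1 \<subset> A" "(A - K1) \<inter> K2 = {}"
    using kernel_avoids[OF assms(2)] by metis
  have "finite A" "card A < k + 1" using F[OF A(1)] by auto
  then obtain B where B: "B \<in> F" "K2 \<subset> B" "(B - K2) \<inter> A = {}"
    using kernel_avoids[OF assms(3)] by metis
  have "A \<inter> B = K1 \<inter> K2" using A B by auto
  with A B show ?thesis by auto
qed

section \<open>Rainbow colourings and colour types\<close>

text \<open>Averaging over all maps from \<open>V\<close> to k colours: a fixed k-set receives all
  colours with probability at least k^(-k), so some map does as well as the average.\<close>

lemma rainbow_coloring:
  assumes "finite V" "\<And>A. A \<in> F \<Longrightarrow> A \<subseteq> V \<and> card A = k"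
  shows "\<exists>c::'a \<Rightarrow> nat. card F \<le> k ^ k * card {A \<in> F. c ` A = {..<k}}"
proof (rule ccontr)
  assume neg: "\<not> ?thesis"
  define \<Phi> where "\<Phi> = (V \<rightarrow>\<^sub>E {..<k})"
  define n where "n = card V"
  have fin\<Phi>: "finite \<Phi>" and card\<Phi>: "card \<Phi> = k ^ n"
    using assms(1) by (auto simp: \<Phi>_def n_def card_PiE finite_PiE)
  have finF: "finite F" using assms by (intro finite_subset[of F "Pow V"]) auto
  have count: "k ^ n \<le> k ^ k * card {c \<in> \<Phi>. c ` A = {..<k}}" if A: "A \<in> F" for A
  proof -
    have AV: "A \<subseteq> V" "card A = k" "finite A" using assms A by (auto intro: finite_subset)
    then obtain b where b: "bij_betw b A {..<k}"
      using ex_bij_betw_finite_nat[of A] by (auto simp: atLeast0LessThan)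
    \<comment> \<open>It is enough to count the colourings that extend the one bijection b; there
      are k^(n - k) of them.\<close>
    have "PiE V (\<lambda>v. if v \<in> A then {b v} else {..<k}) \<subseteq> {c \<in> \<Phi>. c ` A = {..<k}}"
    proof
      fix c assume c: "c \<in> PiE V (\<lambda>v. if v \<in> A then {b v} else {..<k})"
      then have cb: "c v = b v" if "v \<in> A" for v using that AV by (auto dest!: PiE_mem[where x=v])
      then have "c ` A = b ` A" by auto
      moreover have "c v < k" if "v \<in> V" for v
        using that c b cb by (cases "v \<in> A") (auto dest!: PiE_mem[where x=v] bij_betwE)
      ultimately show "c \<in> {c \<in> \<Phi>. c ` A = {..<k}}"
        using c b by (auto simp: \<Phi>_def bij_betw_def PiE_iff)
    qed
    then have "card (PiE V (\<lambda>v. if v \<in> A then {b v} else {..<k})) \<le> card {c \<in> \<Phi>. c ` A = {..<k}}"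
      using fin\<Phi> by (intro card_mono) auto
    moreover have "card (PiE V (\<lambda>v. if v \<in> A then {b v} else {..<k})) = (\<Prod>v\<in>V. if v \<in> A then 1 else k)"
      using assms(1) by (subst card_PiE) (auto intro: prod.cong)
    moreover have "\<dots> = k ^ card (V - A)"
      using assms(1) by (subst prod.If_cases) (auto simp: set_diff_eq Int_def)
    moreover have "card (V - A) = n - k" "k \<le> n" using AV assms(1) by (auto simp: n_def card_Diff_subset card_mono)
    ultimately have "k ^ k * k ^ (n - k) \<le> k ^ k * card {c \<in> \<Phi>. c ` A = {..<k}}" by simp
    then show ?thesis using \<open>k \<le> n\<close> by (simp flip: power_add)
  qed
  have "card F * k ^ n \<le> (\<Sum>A\<in>F. k ^ k * card {c \<in> \<Phi>. c ` A = {..<k}})"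
    using sum_mono[of F "\<lambda>_. k ^ n", OF count] by simp
  also have "\<dots> = k ^ k * (\<Sum>A\<in>F. \<Sum>c\<in>{c \<in> \<Phi>. c ` A = {..<k}}. 1)"
    by (simp add: sum_distrib_left)
  also have "\<dots> = k ^ k * (\<Sum>c\<in>\<Phi>. \<Sum>A\<in>{A \<in> F. c ` A = {..<k}}. 1)"
    using finF fin\<Phi> by (subst sum.swap_restrict) auto
  also have "\<dots> = (\<Sum>c\<in>\<Phi>. k ^ k * card {A \<in> F. c ` A = {..<k}})"
    by (simp add: sum_distrib_left)
  finally have le: "card F * k ^ n \<le> (\<Sum>c\<in>\<Phi>. k ^ k * card {A \<in> F. c ` A = {..<k}})" .
  have "(\<Sum>c\<in>\<Phi>. k ^ k * card {A \<in> F. c ` A = {..<k}}) < (\<Sum>c\<in>\<Phi>. card F)"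
  proof (rule sum_strict_mono)
    show "finite \<Phi>" by fact
    \<comment> \<open>Without colours there may be no map to average over; but then all members are
      empty and any colouring serves.\<close>
    have "k \<noteq> 0"
    proof
      assume "k = 0"
      then have "A = {}" if "A \<in> F" for A
        using assms(2)[OF that] assms(1) by (metis card_0_eq finite_subset)
      then have "{A \<in> F. (\<lambda>_. 0) ` A = {..<k}} = F" using \<open>k = 0\<close> by auto
      then show False using neg \<open>k = 0\<close> by (metis mult_1 order_refl power_0)
    qed
    then show "\<Phi> \<noteq> {}" using card\<Phi> by auto
  qed (use neg in \<open>auto simp: not_le\<close>)
  then show False using le card\<Phi> by (simp add: mult.commute)
qed

text \<open>On a member A that c maps bijectively onto the colours, J \<mapsto>
  \<open>part c J A\<close> runs through all subsets of A. The colour sets are thus common names for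
  the subsets of different members.\<close>

definition part :: "('a \<Rightarrow> nat) \<Rightarrow> nat set \<Rightarrow> 'a set \<Rightarrow> 'a set" where
  "part c J A = {a \<in> A. c a \<in> J}"

section \<open>Passing to a homogeneous subfamily\<close>

text \<open>Members are removed one by one, each labelled with a J whose part is not a kernel in the
  family present at that moment. When the first of the removed members with a given label and part T
  goes, all the others are still there, so a sunflower with kernel T among them would have blocked
  this removal.\<close>

lemma peel:
  fixes \<J> :: "nat set set"
  assumes "finite H"
  shows "\<exists>H1\<subseteq>H. \<exists>j. (\<forall>A\<in>H1. \<forall>J\<in>\<J>. kernel (Suc s) H1 (part c J A)) \<and>
    (\<forall>A\<in>H - H1. j A \<in> \<J>) \<and>
    (\<forall>J T. \<not> kernel (Suc s) {A \<in> H - H1. j A = J \<and> part c J A = T} T)"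
  using assms
proof (induction "card H" arbitrary: H rule: less_induct)
  case less
  show ?case
  proof (cases "\<forall>A\<in>H. \<forall>J\<in>\<J>. kernel (Suc s) H (part c J A)")
    case True
    have "\<not> kernel (Suc s) {} T" for T :: "'a set" unfolding kernel_def by simp
    with True show ?thesis by (intro exI[of _ H]) simp
  next
    case False
    then obtain A J where A: "A \<in> H" "J \<in> \<J>" "\<not> kernel (Suc s) H (part c J A)" by auto
    have "card (H - {A}) < card H" using less.prems A(1) by (rule card_Diff1_less)
    moreover have "finite (H - {A})" using less.prems by (rule finite_Diff)
    ultimately obtain H1 j where IH: "H1 \<subseteq> H - {A}"
      "\<forall>A\<in>H1. \<forall>J\<in>\<J>. kernel (Suc s) H1 (part c J A)"
      "\<forall>B\<in>H - {A} - H1. j B \<in> \<J>"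
      "\<forall>J T. \<not> kernel (Suc s) {B \<in> H - {A} - H1. j B = J \<and> part c J B = T} T"
      using less.hyps[of "H - {A}"] by (elim meta_impE exE conjE) assumption+
    define j' where "j' = j(A := J)"
    have "\<not> kernel (Suc s) {B \<in> H - H1. j' B = J' \<and> part c J' B = T} T" for J' T
    proof (cases "J' = J \<and> T = part c J A")
      case True
      then show ?thesis using A(3) kernel_mono[of "Suc s" "{B \<in> H - H1. j' B = J' \<and> part c J' B = T}" T H] by auto
    next
      case False
      then have "{B \<in> H - H1. j' B = J' \<and> part c J' B = T} = {B \<in> H - {A} - H1. j B = J' \<and> part c J' B = T}"
        using IH(1) by (auto simp: j'_def)
      then show ?thesis using IH(4) by simp
    qed
    moreover have "\<forall>B\<in>H - H1. j' B \<in> \<J>" using IH(3) A(2) by (simp add: j'_def)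
    moreover have "H1 \<subseteq> H" using IH(1) by blast
    ultimately show ?thesis using IH(2) by (intro exI[of _ H1] exI[of _ j'] conjI allI)
  qed
qed

text \<open>A maximum sunflower with kernel T has at most s petals, hence at most s * k points
  outside T. By maximality every member of \<open>P\<close> meets these points, and one of them is
  hit by the required share.\<close>

lemma popular_point:
  assumes P: "finite P" "P \<noteq> {}" "\<And>A. A \<in> P \<Longrightarrow> finite A \<and> card A = k \<and> T \<subset> A"
    and no: "\<not> kernel (Suc s) P T"
  shows "\<exists>v. v \<notin> T \<and> card P \<le> s * k * card {A \<in> P. v \<in> A}"
proof -
  define sun where "sun S \<longleftrightarrow> S \<subseteq> P \<and> (\<forall>A\<in>S. \<forall>B\<in>S. A \<noteq> B \<longrightarrow> A \<inter> B = T)" for S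
  have "\<exists>S. sun S \<and> (\<forall>S'. sun S' \<longrightarrow> card S' \<le> card S)"
  proof (rule ex_has_greatest_nat[where k = "{}" and b = "card P + 1"])
    show "sun {}" by (simp add: sun_def)
    show "\<forall>S. sun S \<longrightarrow> card S < card P + 1"
      using P(1) by (auto simp: sun_def less_Suc_eq_le intro: card_mono)
  qed
  then obtain S where S: "sun S" and maxS: "\<And>S'. sun S' \<Longrightarrow> card S' \<le> card S" by blast
  have SP: "S \<subseteq> P" and finS: "finite S" using S P(1) by (auto simp: sun_def intro: finite_subset)
  have cS: "card S \<le> s"
  proof (rule ccontr)
    assume "\<not> card S \<le> s"
    then have "kernel (Suc s) P T"
      unfolding kernel_def using S SP finS P(3) by (intro exI[of _ S]) (simp add: sun_def subset_iff)
    then show False using no by simp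
  qed
  define W where "W = \<Union>S - T"
  have "card W \<le> card (\<Union>S)"
    unfolding W_def using SP P(3) finS by (intro card_mono finite_Union) blast+
  also have "\<dots> \<le> (\<Sum>A\<in>S. card A)" by (rule card_Union_le_sum_card)
  also have "\<dots> = card S * k" using SP P(3) by (simp add: subset_iff)
  also have "\<dots> \<le> s * k" using cS by simp
  finally have cW: "card W \<le> s * k" .
  have finW: "finite W" unfolding W_def using finS SP P(3) by auto
  have hit: "\<exists>v. v \<in> A \<inter> W" if A: "A \<in> P" for A
  proof (rule ccontr)
    assume no: "\<not> ?thesis"
    have TA: "T \<subset> A" using P(3) A by blast
    then have "A \<notin> S" using no by (auto simp: W_def)
    have "A \<inter> B = T" if "B \<in> S" for B
    proof -
      have "T \<subset> B" using P(3) SP that by blast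
      then show ?thesis using TA no that by (auto simp: W_def)
    qed
    then have "sun (insert A S)" using S A unfolding sun_def by blast
    then have "card (insert A S) \<le> card S" by (rule maxS)
    then show False using \<open>A \<notin> S\<close> finS by simp
  qed
  then obtain f where f: "\<And>A. A \<in> P \<Longrightarrow> f A \<in> A \<inter> W" by metis
  have "W \<noteq> {}" using hit P(2) by blast
  then obtain v where v: "v \<in> W" "card P \<le> card (f -` {v} \<inter> P) * card W"
    using pigeonhole_card[of f P W] f P(1) finW by blast
  have "card P \<le> card (f -` {v} \<inter> P) * card W" by fact
  also have "\<dots> \<le> card {A \<in> P. v \<in> A} * (s * k)"
    using P(1) f cW by (intro mult_mono card_mono) auto
  finally show ?thesis using v(1) by (auto simp: W_def mult.commute)
qed

text \<open>Both colourings are bijective, so the only point of B with a given colour from J is the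
  one supplied by A.\<close>

lemma part_eqI:
  assumes "finite A" "card A = k" "c ` A = {..<k}" "finite B" "card B = k" "c ` B = {..<k}"
    and "part c J A \<subseteq> B"
  shows "part c J B = part c J A"
proof -
  have injA: "inj_on c A" and injB: "inj_on c B" using assms by (auto intro: eq_card_imp_inj_on)
  show ?thesis
  proof
    show "part c J A \<subseteq> part c J B" using assms(7) by (auto simp: part_def)
    show "part c J B \<subseteq> part c J A"
    proof
      fix x assume "x \<in> part c J B"
      then have x: "x \<in> B" "c x \<in> J" by (auto simp: part_def)
      then have "c x \<in> c ` A" using assms by auto
      then obtain y where y: "y \<in> A" "c y = c x" by auto
      then have "y \<in> part c J A" using x by (simp add: part_def)
      then have "y \<in> B" using assms(7) by auto
      then have "y = x" using y x injB by (auto dest: inj_onD)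
      then show "x \<in> part c J A" using \<open>y \<in> part c J A\<close> by simp
    qed
  qed
qed

text \<open>\<open>\<J>\<close> collects the undecided colour sets. If peeling discards most of \<open>H\<close>, a popular \<open>J\<close> is
  decided negatively by forcing one further common point into all members that agree on \<open>J\<close>.\<close>
lemma homogeneous_subfamily:
  fixes c :: "'a \<Rightarrow> nat"
  assumes "finite H" "\<And>A. A \<in> H \<Longrightarrow> finite A \<and> card A = k \<and> c ` A = {..<k}"
    and "finite \<J>" "\<And>J. J \<in> \<J> \<Longrightarrow> J \<subset> {..<k}"
    and "\<And>J A B. J \<subset> {..<k} \<Longrightarrow> J \<notin> \<J> \<Longrightarrow> A \<in> H \<Longrightarrow> B \<in> H \<Longrightarrow> A \<noteq> B \<Longrightarrow> A \<inter> B \<noteq> part c J A"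
  shows "\<exists>H'\<subseteq>H. card H \<le> (2 * 2 ^ k * (Suc s * k)) ^ card \<J> * card H' \<and>
    (\<forall>J. J \<subset> {..<k} \<longrightarrow> (\<forall>A\<in>H'. kernel (Suc s) H' (part c J A)) \<or>
       (\<forall>A\<in>H'. \<forall>B\<in>H'. A \<noteq> B \<longrightarrow> A \<inter> B \<noteq> part c J A))"
  using assms
proof (induction "card \<J>" arbitrary: \<J> H rule: less_induct)
  case less
  \<comment> \<open>The loss in deciding one type: 2 for keeping the larger side, 2^k for the most
    frequent label, \<open>s * k\<close> for the popular points. \<open>Suc s\<close> replaces s so
    that q is at least 2 even for s = 0.\<close>
  define q where "q = 2 * 2 ^ k * (Suc s * k)"
  from peel[OF less.prems(1), of \<J> s c] obtain H1 j where H1: "H1 \<subseteq> H" "\<forall>A\<in>H1. \<forall>J\<in>\<J>. kernel (Suc s) H1 (part c J A)"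
    and j: "\<forall>A\<in>H - H1. j A \<in> \<J>"
    and nok: "\<forall>J T. \<not> kernel (Suc s) {A \<in> H - H1. j A = J \<and> part c J A = T} T"
    by (elim exE conjE)
  show ?case
  proof (cases "\<J> = {}")
    case True
    then show ?thesis using less.prems(5) by (intro exI[of _ H]) auto
  next
    case ne: False
    then have k0: "0 < k" using less.prems(4) by (cases k) auto
    then have q2: "2 \<le> q" unfolding q_def by simp
    \<comment> \<open>A negative decision passes to subfamilies, a positive one need not. Therefore
      positive decisions are made only at the end and all at once, when \<open>H1\<close> is large
      enough.\<close>
    show ?thesis
    proof (cases "card H \<le> 2 * card H1")
      case True
      have "2 \<le> q ^ card \<J>"
        using q2 ne less.prems(3) by (metis (no_types) card_0_eq order_trans self_le_power One_nat_def Suc_leI not_gr0 one_le_numeral)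
      then have "2 * card H1 \<le> q ^ card \<J> * card H1" by simp
      then have "card H \<le> q ^ card \<J> * card H1" using True by linarith
      moreover have "(\<forall>A\<in>H1. kernel (Suc s) H1 (part c J A)) \<or>
         (\<forall>A\<in>H1. \<forall>B\<in>H1. A \<noteq> B \<longrightarrow> A \<inter> B \<noteq> part c J A)" if "J \<subset> {..<k}" for J
        using H1 less.prems(5)[OF that] by (cases "J \<in> \<J>") blast+
      ultimately show ?thesis using H1(1) unfolding q_def by (intro exI[of _ H1] conjI allI impI)
    next
      case False
      define H2 where "H2 = H - H1"
      have cH2: "card H \<le> 2 * card H2" and finH2: "finite H2"
        using False H1(1) less.prems(1) by (auto simp: H2_def card_Diff_subset finite_subset)
      obtain J where J: "J \<in> \<J>" "card H2 \<le> card (j -` {J} \<inter> H2) * card \<J>"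
        using pigeonhole_card[of j H2 \<J>] j finH2 ne less.prems(3) by (auto simp: H2_def)
      have "card \<J> \<le> card (Pow {..<k})" using less.prems(4) by (intro card_mono) auto
      then have cJ: "card \<J> \<le> 2 ^ k" by (simp add: card_Pow)
      define P where "P = {A \<in> H2. j A = J}"
      have finP: "finite P" unfolding P_def using finH2 by simp
      have PH: "P \<subseteq> H" by (auto simp: P_def H2_def)
      have "j -` {J} \<inter> H2 = P" by (auto simp: P_def)
      then have cP: "card H2 \<le> card P * 2 ^ k" using J(2) cJ by (metis mult_le_mono2 order_trans)
      define PT where "PT T = {A \<in> P. part c J A = T}" for T
      define TT where "TT = part c J ` P"
      have "\<exists>v. v \<notin> T \<and> card (PT T) \<le> s * k * card {A \<in> PT T. v \<in> A}" if "T \<in> TT" for T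
      proof (rule popular_point)
        show "finite (PT T)" using finP by (simp add: PT_def)
        show "PT T \<noteq> {}" using that by (auto simp: PT_def TT_def)
        show "\<not> kernel (Suc s) (PT T) T"
          using nok by (simp add: PT_def P_def H2_def conj_assoc)
        fix A assume "A \<in> PT T"
        then have A: "A \<in> H" "T = part c J A" using PH by (auto simp: PT_def)
        have "J \<subset> {..<k}" using J(1) less.prems(4) by blast
        then obtain i where "i < k" "i \<notin> J" by auto
        then obtain x where "x \<in> A" "c x \<notin> J" using less.prems(2)[OF A(1)] by (metis imageE lessThan_iff)
        then show "finite A \<and> card A = k \<and> T \<subset> A"
          using less.prems(2)[OF A(1)] A(2) by (auto simp: part_def)
      qed
      then have "\<forall>T\<in>TT. \<exists>v. v \<notin> T \<and> card (PT T) \<le> s * k * card {A \<in> PT T. v \<in> A}"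
        by blast
      then obtain v where v: "\<And>T. T \<in> TT \<Longrightarrow> v T \<notin> T"
        "\<And>T. T \<in> TT \<Longrightarrow> card (PT T) \<le> s * k * card {A \<in> PT T. v T \<in> A}" by metis
      \<comment> \<open>Members with a common J-part T now also share \<open>v T\<close>, a point
        outside T, so none of them meet exactly in T.\<close>
      define P' where "P' = {A \<in> P. v (part c J A) \<in> A}"
      have "card P = (\<Sum>T\<in>TT. card (PT T))"
        using sum.image_gen[OF finP, of "\<lambda>_. 1::nat" "part c J"] by (simp add: TT_def PT_def)
      also have "\<dots> \<le> (\<Sum>T\<in>TT. s * k * card {A \<in> PT T. v T \<in> A})" by (intro sum_mono v)
      also have "\<dots> = s * k * (\<Sum>T\<in>TT. card {A \<in> P'. part c J A = T})"
        unfolding sum_distrib_left by (intro sum.cong refl arg_cong2[where f = times] arg_cong[where f = card])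
          (auto simp: PT_def P'_def)
      also have "(\<Sum>T\<in>TT. card {A \<in> P'. part c J A = T}) = card P'"
      proof -
        have "card (\<Union>T\<in>TT. {A \<in> P'. part c J A = T}) = (\<Sum>T\<in>TT. card {A \<in> P'. part c J A = T})"
          using finP by (intro card_UN_disjoint) (auto simp: TT_def P'_def)
        moreover have "(\<Union>T\<in>TT. {A \<in> P'. part c J A = T}) = P'" by (auto simp: TT_def P'_def)
        ultimately show ?thesis by simp
      qed
      finally have "card P \<le> s * k * card P'" .
      also have "\<dots> \<le> Suc s * k * card P'" by (intro mult_le_mono1) simp
      finally have "card P * 2 ^ k \<le> Suc s * k * card P' * 2 ^ k" by simp
      with cP cH2 have cHP: "card H \<le> q * card P'" unfolding q_def by (simp add: algebra_simps)
      have P'P: "P' \<subseteq> P" by (auto simp: P'_def)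
      have cJ': "card (\<J> - {J}) < card \<J>" "card \<J> = Suc (card (\<J> - {J}))"
        using card_Suc_Diff1[OF less.prems(3) J(1)] by simp_all
      have "\<exists>H'\<subseteq>P'. card P' \<le> (2 * 2 ^ k * (Suc s * k)) ^ card (\<J> - {J}) * card H' \<and>
        (\<forall>J. J \<subset> {..<k} \<longrightarrow> (\<forall>A\<in>H'. kernel (Suc s) H' (part c J A)) \<or>
         (\<forall>A\<in>H'. \<forall>B\<in>H'. A \<noteq> B \<longrightarrow> A \<inter> B \<noteq> part c J A))"
      proof (rule less.hyps)
        show "finite P'" using P'P finP finite_subset by blast
        show "finite A \<and> card A = k \<and> c ` A = {..<k}" if "A \<in> P'" for A
          using that P'P PH less.prems(2) by blast
        fix J' A B assume *: "J' \<subset> {..<k}" "J' \<notin> \<J> - {J}" "A \<in> P'" "B \<in> P'" "A \<noteq> B"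
        have AB: "A \<in> H" "B \<in> H" using * P'P PH by auto
        show "A \<inter> B \<noteq> part c J' A"
        proof (cases "J' = J")
          case True
          show ?thesis
          proof
            assume eq: "A \<inter> B = part c J' A"
            then have "part c J B = part c J A" using True AB less.prems(2) by (intro part_eqI[of _ k]) auto
            then have "v (part c J A) \<in> A \<inter> B" using * by (auto simp: P'_def)
            moreover have "part c J A \<in> TT" using * P'P by (auto simp: TT_def)
            ultimately show False using v(1) eq True by auto
          qed
        next
          case False
          then show ?thesis using less.prems(5) * AB by auto
        qed
      qed (use cJ' less.prems in auto)
      then obtain H' where H': "H' \<subseteq> P'" "card P' \<le> q ^ card (\<J> - {J}) * card H'"
        "\<forall>J. J \<subset> {..<k} \<longrightarrow> (\<forall>A\<in>H'. kernel (Suc s) H' (part c J A)) \<or>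
         (\<forall>A\<in>H'. \<forall>B\<in>H'. A \<noteq> B \<longrightarrow> A \<inter> B \<noteq> part c J A)"
        unfolding q_def by (elim exE conjE)
      have "card H \<le> q * (q ^ card (\<J> - {J}) * card H')"
        using cHP H'(2) by (meson mult_le_mono2 order_trans)
      then have "card H \<le> q ^ card \<J> * card H'" using cJ'(2) by (simp add: mult.assoc)
      moreover have "H' \<subseteq> H" using H'(1) P'P PH by blast
      ultimately show ?thesis using H'(3) unfolding q_def by (intro exI[of _ H'] conjI)
    qed
  qed
qed

lemma card_part:
  assumes "finite A" "card A = k" "c ` A = {..<k}" "J \<subseteq> {..<k}"
  shows "card (part c J A) = card J"
proof -
  have "inj_on c A" using assms by (auto intro: eq_card_imp_inj_on)
  then have "inj_on c (part c J A)" by (rule inj_on_subset) (auto simp: part_def)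
  moreover have "c ` part c J A = J"
  proof -
    have "J \<subseteq> c ` A" using assms(3,4) by simp
    then show ?thesis unfolding part_def by blast
  qed
  ultimately show ?thesis using card_image by force
qed

lemma part_image:
  assumes "inj_on c A" "Z \<subseteq> A"
  shows "part c (c ` Z) A = Z"
  using assms by (auto simp: part_def inj_on_def)

section \<open>Members without a root\<close>

definition rooted :: "nat \<Rightarrow> 'a set set \<Rightarrow> 'a set \<Rightarrow> 'a set \<Rightarrow> bool" where
  "rooted s F X A \<longleftrightarrow> X \<subseteq> A \<and> (\<forall>Z. X \<subseteq> Z \<longrightarrow> Z \<subset> A \<longrightarrow> kernel s F Z)"

text \<open>The factor k^k is the loss of the rainbow colouring, the next factor that of homogeneity
  over at most 2^k types, and the power of \<open>card V\<close> bounds the homogeneous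
  rest.\<close>

lemma few_unrooted:
  fixes F :: "'a set set"
  assumes V: "finite V" "\<And>A. A \<in> F \<Longrightarrow> A \<subseteq> V \<and> card A = k"
    and av: "avoids_intersection l F" and k: "2 * l + 3 \<le> k"
  shows "card {A \<in> F. \<not> (\<exists>X. card X = l + 1 \<and> rooted (k + 1) F X A)}
    \<le> k ^ k * (2 * 2 ^ k * (Suc k * k)) ^ (2 ^ k) * card V ^ (k - l - 2)"
proof -
  define bad where "bad = {A \<in> F. \<not> (\<exists>X. card X = l + 1 \<and> rooted (k + 1) F X A)}"
  define q where "q = 2 * 2 ^ k * (Suc k * k)"
  have badV: "A \<subseteq> V \<and> card A = k" if "A \<in> bad" for A using that V(2) by (simp add: bad_def)
  from rainbow_coloring[OF V(1) badV] obtain c :: "'a \<Rightarrow> nat"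
    where c: "card bad \<le> k ^ k * card {A \<in> bad. c ` A = {..<k}}" by blast
  define H where "H = {A \<in> bad. c ` A = {..<k}}"
  have Hprop: "finite A \<and> card A = k \<and> c ` A = {..<k}" if "A \<in> H" for A
    using that badV[of A] finite_subset[OF _ V(1)] by (simp add: H_def)
  have "finite bad" using badV V(1) by (intro finite_subset[of bad "Pow V"]) auto
  then have finH: "finite H" by (simp add: H_def)
  have finJ: "finite {J. J \<subset> {..<k}}" by (rule finite_subset[of _ "Pow {..<k}"]) auto
  have "\<exists>H'\<subseteq>H. card H \<le> (2 * 2 ^ k * (Suc k * k)) ^ card {J. J \<subset> {..<k}} * card H' \<and>
    (\<forall>J. J \<subset> {..<k} \<longrightarrow> (\<forall>A\<in>H'. kernel (Suc k) H' (part c J A)) \<or>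
       (\<forall>A\<in>H'. \<forall>B\<in>H'. A \<noteq> B \<longrightarrow> A \<inter> B \<noteq> part c J A))"
    using finH Hprop finJ by (rule homogeneous_subfamily) auto
  then obtain H' where H': "H' \<subseteq> H" "card H \<le> q ^ card {J. J \<subset> {..<k}} * card H'"
    and dich: "\<forall>J. J \<subset> {..<k} \<longrightarrow> (\<forall>A\<in>H'. kernel (Suc k) H' (part c J A)) \<or>
       (\<forall>A\<in>H'. \<forall>B\<in>H'. A \<noteq> B \<longrightarrow> A \<inter> B \<noteq> part c J A)"
    unfolding q_def by (elim exE conjE)
  have H'F: "H' \<subseteq> F" "H' \<subseteq> bad" using H'(1) by (auto simp: H_def bad_def)
  have H'prop: "finite A" "card A = k" "c ` A = {..<k}" "inj_on c A" if "A \<in> H'" for A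
    using that Hprop H'(1) by (auto intro!: eq_card_imp_inj_on)
  have inter: "\<exists>A\<in>H'. \<exists>B\<in>H'. K1 \<subseteq> A \<and> K2 \<subseteq> B \<and> A \<inter> B = K1 \<inter> K2"
    if "kernel (Suc k) H' K1" "kernel (Suc k) H' K2" for K1 K2
    using that H'prop by (intro kernels_inter[of H' k]) auto
  have "card H' \<le> card V ^ (k - l - 2)"
  proof (cases "H' = {}")
    case False
    then obtain A0 where A0: "A0 \<in> H'" by blast
    text \<open>Complements of the colour types of kernels; intersections of types become unions.\<close>
    define N where "N = {M. M \<subseteq> {..<k} \<and> (M = {} \<or> (\<forall>A\<in>H'. kernel (Suc k) H' (part c ({..<k} - M) A)))}"
    have un: "M \<union> M' \<in> N" if M: "M \<in> N" "M' \<in> N" for M M'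
    proof (cases "M = {} \<or> M' = {}")
      case False
      define J J' where "J = {..<k} - M" and "J' = {..<k} - M'"
      have JJ: "{..<k} - (M \<union> M') = J \<inter> J'" by (auto simp: J_def J'_def)
      have proper: "J \<subset> {..<k}" "J \<inter> J' \<subset> {..<k}" using M False by (auto simp: N_def J_def)
      have "kernel (Suc k) H' (part c J A0)" "kernel (Suc k) H' (part c J' A0)"
        using M False A0 by (auto simp: N_def J_def J'_def)
      from inter[OF this] obtain A B where AB: "A \<in> H'" "B \<in> H'" "part c J A0 \<subseteq> A"
        "A \<inter> B = part c J A0 \<inter> part c J' A0" by blast
      have eq: "part c J A0 \<inter> part c J' A0 = part c (J \<inter> J') A0" by (auto simp: part_def)
      have "part c (J \<inter> J') A = part c (J \<inter> J') A0"
        using AB(3) by (intro part_eqI[of A0 k c A] H'prop AB A0) (auto simp: part_def)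
      then have 1: "A \<inter> B = part c (J \<inter> J') A" using AB(4) eq by simp
      have "card (part c (J \<inter> J') A) < k"
        using card_part[of A k c "J \<inter> J'"] H'prop[OF AB(1)] proper
        by (metis card_lessThan finite_lessThan psubset_card_mono psubset_imp_subset)
      then have "A \<noteq> B" using 1 H'prop(2)[OF AB(1)] by auto
      \<comment> \<open>Two members meet exactly in their part of type \<open>J \<inter> J'\<close>.
        This refutes the negative alternative, so the type is a kernel type for all members.\<close>
      then have "\<forall>A\<in>H'. kernel (Suc k) H' (part c (J \<inter> J') A)"
        using dich proper(2) AB(1,2) 1 by blast
      then show ?thesis using M JJ by (auto simp: N_def)
    qed (use M in auto)
    \<comment> \<open>Such an M would give a kernel with l points, and a kernel combined with itself
      is realised as the intersection of two members.\<close>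
    have size: "card M \<noteq> k - l" if M: "M \<in> N" for M
    proof
      assume cM: "card M = k - l"
      then have "M \<noteq> {}" using k by auto
      then have "kernel (Suc k) H' (part c ({..<k} - M) A0)" using M A0 by (auto simp: N_def)
      from inter[OF this this] obtain A B where AB: "A \<in> H'" "B \<in> H'"
        "A \<inter> B = part c ({..<k} - M) A0" by auto
      have "card ({..<k} - M) = l"
        using M cM k by (auto simp: N_def card_Diff_subset finite_subset[of M "{..<k}"])
      then have "card (A \<inter> B) = l" using AB(3) card_part[OF H'prop(1-3)[OF A0]] by simp
      moreover have "A \<in> F" "B \<in> F" using AB H'F by auto
      ultimately show False using av unfolding avoids_intersection_def by blast
    qed
    show ?thesis
    \<comment> \<open>If the density condition holds, \<open>A0\<close> gets a root although it is
      rootless; if it fails for D, the colours outside D determine each member.\<close>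
    proof (cases "\<forall>D. D \<subseteq> {..<k} \<longrightarrow> card D = l + 2 \<longrightarrow> (\<exists>M\<in>N. M \<noteq> {} \<and> M \<subseteq> D)")
      case True
      have "\<exists>Y\<subseteq>{..<k}. card Y = k - l - 1 \<and> (\<forall>y\<in>Y. {y} \<in> N)"
        by (rule union_closed_many_singletons[OF _ _ k]) (use True un size in \<open>auto simp: N_def\<close>)
      then obtain Y where Y: "Y \<subseteq> {..<k}" "card Y = k - l - 1" "\<And>y. y \<in> Y \<Longrightarrow> {y} \<in> N" by blast
      have finY: "finite Y" using Y(1) finite_subset by blast
      have subN: "M \<in> N" if "M \<noteq> {}" "M \<subseteq> Y" for M
      proof -
        have "finite M" using that finY finite_subset by blast
        then show ?thesis using that
        proof (induction M rule: finite_ne_induct)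
          case (singleton x)
          then show ?case using Y(3) by simp
        next
          case (insert x M)
          then show ?case using un[of "{x}" M] Y(3) by auto
        qed
      qed
      \<comment> \<open>A proper subset of \<open>A0\<close> containing X misses a nonempty set of
        colours from Y, and union-closure puts all such sets into \<open>N\<close>.\<close>
      define X where "X = part c ({..<k} - Y) A0"
      have "card ({..<k} - Y) = l + 1" using Y finY k by (simp add: card_Diff_subset)
      then have cX: "card X = l + 1" using card_part[OF H'prop(1-3)[OF A0]] by (simp add: X_def)
      have "kernel (k + 1) F Z" if Z: "X \<subseteq> Z" "Z \<subset> A0" for Z
      proof -
        have ZA: "part c (c ` Z) A0 = Z" using Z H'prop(4)[OF A0] by (intro part_image) auto
        define M where "M = {..<k} - c ` Z"
        have cZ: "c ` Z \<subseteq> {..<k}" using Z H'prop(3)[OF A0] by auto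
        have "M \<noteq> {}"
        proof
          assume "M = {}"
          then have "c ` Z = c ` A0" using cZ H'prop(3)[OF A0] by (auto simp: M_def)
          then show False using Z ZA by (auto simp: part_def)
        qed
        moreover have "M \<subseteq> Y"
        proof
          fix i assume i: "i \<in> M"
          show "i \<in> Y"
          proof (rule ccontr)
            assume "i \<notin> Y"
            have "i \<in> c ` A0" using i H'prop(3)[OF A0] by (simp add: M_def)
            then obtain x where "x \<in> A0" "c x = i" by blast
            then have "x \<in> X" using \<open>i \<notin> Y\<close> i by (auto simp: X_def part_def M_def)
            then show False using Z(1) i \<open>c x = i\<close> by (auto simp: M_def)
          qed
        qed
        ultimately have "kernel (Suc k) H' (part c ({..<k} - M) A0)"
          using subN[of M] A0 by (auto simp: N_def)
        moreover have "{..<k} - M = c ` Z" using cZ by (auto simp: M_def)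
        ultimately have "kernel (k + 1) H' Z" using ZA by simp
        then show ?thesis using H'F(1) by (rule kernel_mono)
      qed
      then have "rooted (k + 1) F X A0" by (auto simp: rooted_def X_def part_def)
      then show ?thesis using A0 H'F(2) cX by (auto simp: bad_def)
    next
      case False
      then obtain D where D: "D \<subseteq> {..<k}" "card D = l + 2"
        and "\<not> (\<exists>M\<in>N. M \<noteq> {} \<and> M \<subseteq> D)"
        unfolding not_all not_imp by (elim exE conjE)
      then have noN: "M \<in> N \<Longrightarrow> M \<noteq> {} \<Longrightarrow> \<not> M \<subseteq> D" for M by metis
      define J0 where "J0 = {..<k} - D"
      have cJ0: "card J0 = k - l - 2"
        using D k by (simp add: J0_def card_Diff_subset finite_subset[OF D(1)])
      \<comment> \<open>Two members that agree on \<open>J0\<close> meet in a part whose type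
        contains \<open>J0\<close>. By the dichotomy this is a kernel type, and its complement would
        be a nonempty member of \<open>N\<close> inside D.\<close>
      have "inj_on (part c J0) H'"
      proof (rule inj_onI, rule ccontr)
        fix A B assume AB: "A \<in> H'" "B \<in> H'" "part c J0 A = part c J0 B" "A \<noteq> B"
        define J where "J = c ` (A \<inter> B)"
        have eq: "A \<inter> B = part c J A" unfolding J_def using H'prop(4)[OF AB(1)] by (simp add: part_image)
        have JK: "J \<subseteq> {..<k}" using H'prop(3)[OF AB(1)] by (auto simp: J_def)
        moreover have "J \<noteq> {..<k}"
        proof
          assume "J = {..<k}"
          then have "A \<subseteq> B" using eq H'prop(3)[OF AB(1)] by (auto simp: part_def)
          then show False using AB H'prop by (metis card_subset_eq)
        qed
        ultimately have Jp: "J \<subset> {..<k}" by blast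
        then have "\<forall>A\<in>H'. kernel (Suc k) H' (part c J A)" using dich eq AB by blast
        moreover have "{..<k} - ({..<k} - J) = J" using JK by auto
        ultimately have "{..<k} - J \<in> N" by (auto simp: N_def)
        moreover have "{..<k} - J \<noteq> {}" using Jp by auto
        moreover have "{..<k} - J \<subseteq> D"
        proof
          fix i assume i: "i \<in> {..<k} - J"
          show "i \<in> D"
          proof (rule ccontr)
            assume "i \<notin> D"
            have "i \<in> c ` A" using i H'prop(3)[OF AB(1)] by simp
            then obtain x where x: "x \<in> A" "c x = i" by blast
            then have "x \<in> part c J0 A" using i \<open>i \<notin> D\<close> by (auto simp: J0_def part_def)
            then have "x \<in> B" using AB(3) by (auto simp: part_def)
            then show False using x i by (auto simp: J_def)
          qed
        qed
        ultimately show False using noN by metis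
      qed
      moreover have "part c J0 ` H' \<subseteq> {T. T \<subseteq> V \<and> card T = k - l - 2}"
      proof
        fix T assume "T \<in> part c J0 ` H'"
        then obtain A where A: "A \<in> H'" "T = part c J0 A" by auto
        then have "A \<subseteq> V" using H'F V(2) by blast
        moreover have "card T = k - l - 2"
          using A card_part[OF H'prop(1-3)[OF A(1)], of J0] cJ0 by (simp add: J0_def)
        ultimately show "T \<in> {T. T \<subseteq> V \<and> card T = k - l - 2}" using A by (auto simp: part_def)
      qed
      ultimately have "card H' \<le> card {T. T \<subseteq> V \<and> card T = k - l - 2}"
        using V(1) by (intro card_inj_on_le[of "part c J0"]) auto
      also have "\<dots> = card V choose (k - l - 2)" using V(1) by (rule n_subsets)
      also have "\<dots> \<le> card V ^ (k - l - 2)"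
        by (cases "k - l - 2 \<le> card V") (auto simp: binomial_le_pow binomial_eq_0)
      finally show ?thesis .
    qed
  qed simp
  moreover have "q ^ card {J. J \<subset> {..<k}} \<le> q ^ (2 ^ k)"
  proof (rule power_increasing)
    have "card {J. J \<subset> {..<k}} \<le> card (Pow {..<k})" by (intro card_mono) auto
    then show "card {J. J \<subset> {..<k}} \<le> 2 ^ k" by (simp add: card_Pow)
    show "1 \<le> q" using k by (simp add: q_def)
  qed
  ultimately have "q ^ card {J. J \<subset> {..<k}} * card H' \<le> q ^ (2 ^ k) * card V ^ (k - l - 2)"
    by (rule mult_le_mono[rotated])
  then have "card H \<le> q ^ (2 ^ k) * card V ^ (k - l - 2)" using H'(2) by linarith
  then have "k ^ k * card H \<le> k ^ k * (q ^ (2 ^ k) * card V ^ (k - l - 2))" by (rule mult_le_mono2)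
  then have "card bad \<le> k ^ k * (q ^ (2 ^ k) * card V ^ (k - l - 2))"
    using c unfolding H_def by linarith
  then show ?thesis unfolding bad_def q_def by (simp only: mult.assoc)
qed

subsection \<open>Shadows\<close>

lemma sum_card_containing:
  assumes "finite V" "finite G"
  shows "(\<Sum>v\<in>V. card {A \<in> G. v \<in> A}) = (\<Sum>A\<in>G. card (A \<inter> V))"
proof -
  have "(\<Sum>v\<in>V. card {A \<in> G. v \<in> A}) = (\<Sum>v\<in>V. \<Sum>A\<in>{A \<in> G. v \<in> A}. 1)" by simp
  also have "\<dots> = (\<Sum>A\<in>G. \<Sum>v\<in>{v \<in> V. v \<in> A}. 1)" using assms by (rule sum.swap_restrict)
  also have "\<dots> = (\<Sum>A\<in>G. card (A \<inter> V))" by (simp add: Int_def conj_commute)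
  finally show ?thesis .
qed

text \<open>This is the Loomis-Whitney inequality for the set of ordered tuples of members: there
  are (r + 1)! \<open>card G\<close> of them, and each of the r + 1 coordinate projections has at
  most r! \<open>card D\<close> elements. The induction runs over the links of vertices.
  \<open>D\<close> may exceed the shadow, so that the links of \<open>D\<close> are admissible
  again.\<close>

lemma loomis_whitney_shadow:
  fixes G D :: "'a set set"
  assumes "finite G" "finite D" "G \<noteq> {}" "\<And>A. A \<in> G \<Longrightarrow> card A = Suc r"
    and "\<And>A v. A \<in> G \<Longrightarrow> v \<in> A \<Longrightarrow> A - {v} \<in> D" "\<And>B. B \<in> D \<Longrightarrow> finite B \<and> card B = r"
  shows "(fact (Suc r) * real (card G)) ^ r \<le> (fact r * real (card D)) ^ Suc r"
  using assms
proof (induction r arbitrary: G D)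
  \<comment> \<open>The left side is a zeroth power, hence 1, and \<open>D\<close> has to be
    nonempty; this is where \<open>G \<noteq> {}\<close> enters.\<close>
  case 0
  obtain A where A: "A \<in> G" using 0 by blast
  then obtain v where "v \<in> A" using 0(4)[OF A] by (metis card.empty equals0I nat.distinct(1))
  then have "D \<noteq> {}" using 0(5) A by blast
  then show ?case using 0(2) by (simp add: Suc_leI card_gt_0_iff)
next
  case (Suc r)
  have finA: "finite A" if "A \<in> G" for A using Suc.prems(4)[OF that] by (metis card.infinite nat.distinct(1))
  define V where "V = \<Union>G"
  have finV: "finite V" using Suc.prems(1) finA by (auto simp: V_def)
  define d e where "d v = card {A \<in> G. v \<in> A}" and "e v = card {B \<in> D. v \<in> B}" for v
  \<comment> \<open>The link of v in \<open>G\<close> is contained in \<open>D\<close>, so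
    \<open>d v \<le> card D\<close>. Multiplying the induction hypothesis by this bound makes both
    exponents \<open>Suc r\<close>, and \<beta> is what the root leaves of it.\<close>
  define \<beta> where "\<beta> = root (Suc r) (fact (Suc r) * real (card D))"
  have \<beta>: "0 \<le> \<beta>" "\<beta> ^ Suc r = fact (Suc r) * real (card D)"
    unfolding \<beta>_def by (rule real_root_ge_zero real_root_pow_pos2; simp)+
  have vertex: "fact (Suc r) * real (d v) \<le> fact r * real (e v) * \<beta>" if v: "v \<in> V" for v
  proof -
    define G' D' where "G' = (\<lambda>A. A - {v}) ` {A \<in> G. v \<in> A}" and "D' = (\<lambda>A. A - {v}) ` {A \<in> D. v \<in> A}"
    have inj: "inj_on (\<lambda>A. A - {v}) {A \<in> S. v \<in> A}" for S by (auto simp: inj_on_def)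
    have c: "card G' = d v" "card D' = e v"
      unfolding G'_def D'_def d_def e_def by (rule card_image[OF inj])+
    have "(fact (Suc r) * real (card G')) ^ r \<le> (fact r * real (card D')) ^ Suc r"
    proof (rule Suc.IH)
      show "finite G'" "finite D'" using Suc.prems by (auto simp: G'_def D'_def)
      show "G' \<noteq> {}" using v by (auto simp: G'_def V_def)
      show "card A = Suc r" if "A \<in> G'" for A
        using that Suc.prems(4) finA by (auto simp: G'_def card_Diff_singleton)
      show "A - {w} \<in> D'" if A: "A \<in> G'" "w \<in> A" for A w
      proof -
        obtain B where B: "B \<in> G" "v \<in> B" "A = B - {v}" using A(1) by (auto simp: G'_def)
        then have "B - {w} \<in> D" "v \<in> B - {w}" using A(2) Suc.prems(5) by auto
        moreover have "A - {w} = B - {w} - {v}" using B by auto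
        ultimately show ?thesis unfolding D'_def by blast
      qed
      show "finite B \<and> card B = r" if "B \<in> D'" for B
        using that Suc.prems(6) by (auto simp: D'_def card_Diff_singleton)
    qed
    then have 1: "(fact (Suc r) * real (d v)) ^ r \<le> (fact r * real (e v)) ^ Suc r" using c by simp
    have "G' \<subseteq> D" using Suc.prems(5) by (auto simp: G'_def)
    then have "d v \<le> card D" using c Suc.prems(2) card_mono by metis
    then have "(fact (Suc r) * real (d v)) ^ r * (fact (Suc r) * real (d v))
      \<le> (fact r * real (e v)) ^ Suc r * (fact (Suc r) * real (card D))"
      using 1 by (intro mult_mono) auto
    then have "(fact (Suc r) * real (d v)) ^ Suc r \<le> (fact r * real (e v) * \<beta>) ^ Suc r"
      using \<beta>(2) by (simp only: power_Suc2[of "fact (Suc r) * real (d v)"] power_mult_distrib[of _ \<beta>])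
    then show ?thesis by (rule power_le_imp_le_base) (use \<beta>(1) in simp)
  qed
  have sd: "(\<Sum>v\<in>V. d v) = Suc (Suc r) * card G"
  proof -
    have "A \<inter> V = A" if "A \<in> G" for A using that by (auto simp: V_def)
    then show ?thesis using Suc.prems(1,4) finV by (simp add: d_def sum_card_containing)
  qed
  have se: "(\<Sum>v\<in>V. e v) \<le> Suc r * card D"
  proof -
    have "card (B \<inter> V) \<le> Suc r" if "B \<in> D" for B
      using Suc.prems(6)[OF that] by (metis card_mono inf_le1)
    then have "(\<Sum>B\<in>D. card (B \<inter> V)) \<le> (\<Sum>B\<in>D. Suc r)" by (intro sum_mono)
    then show ?thesis using Suc.prems(2) finV by (simp add: e_def sum_card_containing mult.commute)
  qed
  have "fact (Suc (Suc r)) * real (card G) = fact (Suc r) * real (\<Sum>v\<in>V. d v)"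
    unfolding sd by (simp add: algebra_simps)
  also have "\<dots> = (\<Sum>v\<in>V. fact (Suc r) * real (d v))" by (simp only: of_nat_sum sum_distrib_left)
  also have "\<dots> \<le> (\<Sum>v\<in>V. fact r * real (e v) * \<beta>)" by (intro sum_mono vertex)
  also have "\<dots> = fact r * \<beta> * real (\<Sum>v\<in>V. e v)"
    by (simp only: of_nat_sum sum_distrib_left) (simp add: algebra_simps)
  also have "\<dots> \<le> fact r * \<beta> * real (Suc r * card D)" 
    using se \<beta>(1) by (intro mult_left_mono) (simp_all only: of_nat_le_iff, simp)
  also have "\<dots> = fact (Suc r) * real (card D) * \<beta>" by (simp add: algebra_simps)
  finally have "(fact (Suc (Suc r)) * real (card G)) ^ Suc r \<le> (fact (Suc r) * real (card D) * \<beta>) ^ Suc r"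
    by (intro power_mono) auto
  also have "\<dots> = (fact (Suc r) * real (card D)) ^ Suc r * \<beta> ^ Suc r" by (rule power_mult_distrib)
  also have "\<dots> = (fact (Suc r) * real (card D)) ^ Suc (Suc r)" by (simp only: \<beta>(2) power_Suc2[of _ "Suc r"])
  finally show ?case .
qed

lemma power_powr:
  assumes "0 \<le> (x::real)" "1 \<le> m"
  shows "(x ^ m) powr (1 / (real m * p)) = x powr (1 / p)"
proof (cases "x = 0")
  case False
  then have "x ^ m = x powr real m" using assms by (simp add: powr_realpow)
  then show ?thesis using assms(2) by (simp add: powr_powr)
qed (use assms in auto)

definition shadow :: "nat \<Rightarrow> 'a set set \<Rightarrow> 'a set set" where
  "shadow j G = {T. finite T \<and> card T = j \<and> (\<exists>A\<in>G. T \<subseteq> A)}"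

text \<open>The Loomis-Whitney bound between neighbouring levels says that (j! times the size of the
  j-shadow)^(1/j) does not increase with j. Descending from r, where the shadow is \<open>G\<close>
  itself, gives the claim.\<close>

lemma card_shadow_lower:
  fixes G :: "'a set set"
  assumes G: "finite G" "\<And>A. A \<in> G \<Longrightarrow> finite A \<and> card A = r" and j: "1 \<le> j" "j \<le> r"
  shows "(fact r * real (card G)) powr (real j / real r) \<le> fact j * real (card (shadow j G))"
proof (cases "G = {}")
  case ne: False
  have fin: "finite (shadow j G)" for j
    by (rule finite_subset[of _ "Pow (\<Union>G)"]) (use G in \<open>auto simp: shadow_def\<close>)
  have nempty: "shadow j G \<noteq> {}" if "j \<le> r" for j
  proof -
    obtain A where A: "A \<in> G" using ne by blast
    have "j \<le> card A" using G(2)[OF A] that by simp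
    then obtain T where "T \<subseteq> A" "card T = j" "finite T" by (rule obtain_subset_with_card_n)
    then show ?thesis using A by (auto simp: shadow_def)
  qed
  define a where "a j = fact j * real (card (shadow j G))" for j
  have a0: "0 \<le> a j" for j by (simp add: a_def)
  have "1 \<le> j \<longrightarrow> a r powr (1 / real r) \<le> a j powr (1 / real j)"
    using j(2)
  proof (induction rule: inc_induct)
    case (step n)
    show ?case
    proof
      assume n: "1 \<le> n"
      have "a (Suc n) ^ n \<le> a n ^ Suc n"
        unfolding a_def
      proof (rule loomis_whitney_shadow[OF fin fin nempty])
        show "Suc n \<le> r" using step by simp
        fix A v assume "A \<in> shadow (Suc n) G" "v \<in> A"
        then show "A - {v} \<in> shadow n G" by (auto simp: shadow_def card_Diff_singleton)
      qed (auto simp: shadow_def)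
      then have "(a (Suc n) ^ n) powr (1 / (real n * real (Suc n))) \<le> (a n ^ Suc n) powr (1 / (real n * real (Suc n)))"
        using a0 by (intro powr_mono2) auto
      moreover have "(a (Suc n) ^ n) powr (1 / (real n * real (Suc n))) = a (Suc n) powr (1 / real (Suc n))"
        using n a0 by (intro power_powr) auto
      moreover have "(a n ^ Suc n) powr (1 / (real n * real (Suc n))) = a n powr (1 / real n)"
        using power_powr[OF a0[of n], of "Suc n" "real n"] by (simp add: mult.commute del: power_Suc of_nat_Suc)
      ultimately have "a (Suc n) powr (1 / real (Suc n)) \<le> a n powr (1 / real n)" by simp
      moreover have "a r powr (1 / real r) \<le> a (Suc n) powr (1 / real (Suc n))"
        using step.IH by (simp del: of_nat_Suc)
      ultimately show "a r powr (1 / real r) \<le> a n powr (1 / real n)" by (rule order_trans[rotated])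
    qed
  qed simp
  then have "a r powr (1 / real r) \<le> a j powr (1 / real j)" using j by simp
  then have "(a r powr (1 / real r)) powr real j \<le> (a j powr (1 / real j)) powr real j"
    by (intro powr_mono2) (use j in simp_all)
  then have "a r powr (real j / real r) \<le> a j" using j a0[of j] by (simp add: powr_powr)
  moreover have "shadow r G = G"
  proof (intro equalityI subsetI)
    fix T assume "T \<in> shadow r G"
    then obtain A where "A \<in> G" "T \<subseteq> A" "card T = r" by (auto simp: shadow_def)
    moreover from this have "T = A" using G(2) by (intro card_subset_eq) auto
    ultimately show "T \<in> G" by simp
  qed (use G(2) in \<open>auto simp: shadow_def\<close>)
  ultimately show ?thesis by (simp add: a_def)
qed simp

section \<open>Decomposition of the family by roots\<close>

text \<open>Since X and Y differ, they share at most l points. Adding to both the same S from T tops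
  up the intersection to exactly l points, and the enlarged sets are still kernels, so F would
  realise the intersection size l.\<close>

lemma roots_disjoint:
  assumes F: "\<And>A. A \<in> F \<Longrightarrow> finite A \<and> card A = k" and av: "avoids_intersection l F"
    and k: "2 * l + 1 < k" and X: "card X = l + 1" "card Y = l + 1" "X \<noteq> Y"
    and A: "A \<in> F" "rooted (k + 1) F X A" and B: "B \<in> F" "rooted (k + 1) F Y B"
    and T: "T \<subseteq> A - X" "T \<subseteq> B - Y" "card T = l"
  shows False
proof -
  have fin: "finite X" "finite Y" "finite T"
    using A(2) B(2) T F[OF A(1)] F[OF B(1)] unfolding rooted_def by (meson finite_Diff finite_subset)+
  have "\<not> X \<subseteq> Y" using card_subset_eq[OF fin(2), of X] X by metis
  then have "X \<inter> Y \<subset> X" by blast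
  then have "card (X \<inter> Y) < card X" by (rule psubset_card_mono[OF fin(1)])
  then have "card (X \<inter> Y) \<le> l" using X(1) by simp
  then have "l - card (X \<inter> Y) \<le> card T" using T(3) by simp
  then obtain S where S: "S \<subseteq> T" "card S = l - card (X \<inter> Y)" "finite S" by (rule obtain_subset_with_card_n)
  have kern: "kernel (k + 1) F (Z \<union> S)" if "C \<in> F" "rooted (k + 1) F Z C" "card Z = l + 1" "T \<subseteq> C" for Z C
  proof -
    \<comment> \<open>At most (l + 1) + l < k points, so \<open>Z \<union> S\<close> is a proper
      subset of C as a kernel has to be.\<close>
    have "card (Z \<union> S) \<le> card Z + card S" by (rule card_Un_le)
    also have "\<dots> < card C" using F[OF that(1)] that(3) S(2) k by simp
    finally have "Z \<union> S \<noteq> C" by blast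
    then show ?thesis using that S(1) unfolding rooted_def by blast
  qed
  have "kernel (k + 1) F (X \<union> S)" "kernel (k + 1) F (Y \<union> S)"
    using kern[of A X] kern[of B Y] A B X T by auto
  then obtain C D where CD: "C \<in> F" "D \<in> F" "C \<inter> D = (X \<union> S) \<inter> (Y \<union> S)"
    using kernels_inter[OF F, where ?K1.0 = "X \<union> S" and ?K2.0 = "Y \<union> S"] by metis
  have "(X \<union> S) \<inter> (Y \<union> S) = (X \<inter> Y) \<union> S" "(X \<inter> Y) \<inter> S = {}" using S(1) T by auto
  then have "card (C \<inter> D) = l" using CD(3) S fin \<open>card (X \<inter> Y) \<le> l\<close> by (simp add: card_Un_disjoint)
  then show False using av CD unfolding avoids_intersection_def by blast
qed

text \<open>The function g holds all that the estimates need from \<open>F\<close>. One root is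
  chosen for each member, so the classes are disjoint and their sizes add up. The l-shadows of the
  links are disjoint families of l-subsets of \<open>V\<close>, which gives the first conjunct; a
  member that does not contain X is rootless or was given another root, which gives the
  last.\<close>

lemma root_decomposition:
  fixes F :: "'a set set"
  assumes V: "finite V" "\<And>A. A \<in> F \<Longrightarrow> A \<subseteq> V \<and> card A = k"
    and av: "avoids_intersection l F" and k: "2 * l + 3 \<le> k" and l: "1 \<le> l"
  defines "r \<equiv> k - l - 1" and "\<X> \<equiv> {X. X \<subseteq> V \<and> card X = l + 1}"
    and "M \<equiv> k ^ k * (2 * 2 ^ k * (Suc k * k)) ^ (2 ^ k)"
  shows "\<exists>g::'a set \<Rightarrow> nat. (\<Sum>X\<in>\<X>. (fact r * real (g X)) powr (real l / real r)) \<le> real (card V) ^ l \<and>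
    card F \<le> (\<Sum>X\<in>\<X>. g X) + M * card V ^ (r - 1) \<and>
    (\<forall>X\<in>\<X>. card (F - subfamily_containing F X) \<le> (\<Sum>Y\<in>\<X> - {X}. g Y) + M * card V ^ (r - 1))"
proof -
  have finF: "finite F" using V by (intro finite_subset[of F "Pow V"]) auto
  have Fk: "finite A \<and> card A = k" if "A \<in> F" for A using V(2)[OF that] finite_subset[OF _ V(1)] by blast
  have fin\<X>: "finite \<X>" using V(1) by (simp add: \<X>_def)
  define bad where "bad = {A \<in> F. \<not> (\<exists>X. card X = l + 1 \<and> rooted (k + 1) F X A)}"
  have cbad: "card bad \<le> M * card V ^ (r - 1)"
  proof -
    have "card bad \<le> M * card V ^ (k - l - 2)"
      unfolding bad_def M_def using V av k by (rule few_unrooted)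
    moreover have "k - l - 2 = r - 1" by (simp add: r_def)
    ultimately show ?thesis by simp
  qed
  have finbad: "finite bad" using finF by (simp add: bad_def)
  have "\<forall>A\<in>F - bad. \<exists>X. card X = l + 1 \<and> rooted (k + 1) F X A" by (simp add: bad_def)
  then obtain \<rho> where \<rho>: "\<And>A. A \<in> F - bad \<Longrightarrow> card (\<rho> A) = l + 1 \<and> rooted (k + 1) F (\<rho> A) A" by metis
  have \<rho>A: "\<rho> A \<subseteq> A" "\<rho> A \<in> \<X>" if "A \<in> F - bad" for A
    using \<rho>[OF that] V(2)[of A] that by (auto simp: rooted_def \<X>_def)
  define \<G> where "\<G> X = {A \<in> F - bad. \<rho> A = X}" for X
  define g where "g X = card (\<G> X)" for X
  have fin\<G>: "finite (\<G> X)" for X using finF by (simp add: \<G>_def)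
  have sumg: "card (\<Union>X\<in>S. \<G> X) = (\<Sum>X\<in>S. g X)" if "S \<subseteq> \<X>" for S
    unfolding g_def using that fin\<X> fin\<G> by (intro card_UN_disjoint) (auto simp: \<G>_def finite_subset)
  have finU: "finite (\<Union>X\<in>S. \<G> X)" for S using finF by (rule finite_subset[rotated]) (auto simp: \<G>_def)
  define L where "L X = (\<lambda>A. A - X) ` \<G> X" for X
  have L: "finite A \<and> card A = r" if "A \<in> L X" for A X
  proof -
    from that obtain B where B: "B \<in> F - bad" "\<rho> B = X" "A = B - X" unfolding L_def \<G>_def by blast
    have "X \<subseteq> B" "card X = l + 1" "finite B" "card B = k"
      using \<rho>A(1)[OF B(1)] \<rho>[OF B(1)] B Fk[of B] by auto
    then show ?thesis using B(3) by (simp add: card_Diff_subset finite_subset r_def)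
  qed
  have cL: "card (L X) = g X" for X
    unfolding L_def g_def
  proof (rule card_image, rule inj_onI)
    fix A B assume AB: "A \<in> \<G> X" "B \<in> \<G> X" "A - X = B - X"
    have "X \<subseteq> A" "X \<subseteq> B" using AB \<rho>A(1)[of A] \<rho>A(1)[of B] by (auto simp: \<G>_def)
    then show "A = B" using AB(3) by blast
  qed
  have shadowV: "shadow l (L X) \<subseteq> {T. T \<subseteq> V \<and> card T = l}" for X
    using V(2) by (auto simp: shadow_def L_def \<G>_def)
  have disj: "shadow l (L X) \<inter> shadow l (L Y) = {}" if XY: "X \<in> \<X>" "Y \<in> \<X>" "X \<noteq> Y" for X Y
  proof (rule ccontr)
    assume "shadow l (L X) \<inter> shadow l (L Y) \<noteq> {}"
    then obtain T A B where T: "card T = l" "A \<in> \<G> X" "T \<subseteq> A - X" "B \<in> \<G> Y" "T \<subseteq> B - Y"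
      unfolding shadow_def L_def by blast
    show False
      by (rule roots_disjoint[OF Fk av, of X Y A B T])
        (use T XY k \<rho>[of A] \<rho>[of B] in \<open>auto simp: \<G>_def \<X>_def\<close>)
  qed
  have "(\<Sum>X\<in>\<X>. (fact r * real (g X)) powr (real l / real r)) \<le> (\<Sum>X\<in>\<X>. fact l * real (card (shadow l (L X))))"
  proof (rule sum_mono)
    fix X assume "X \<in> \<X>"
    have "finite (L X)" using fin\<G> by (simp add: L_def)
    then show "(fact r * real (g X)) powr (real l / real r) \<le> fact l * real (card (shadow l (L X)))"
      using card_shadow_lower[of "L X" r l] L l k by (simp add: cL r_def)
  qed
  also have "\<dots> = fact l * real (\<Sum>X\<in>\<X>. card (shadow l (L X)))" by (simp add: sum_distrib_left)
  also have "(\<Sum>X\<in>\<X>. card (shadow l (L X))) = card (\<Union>X\<in>\<X>. shadow l (L X))"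
    using fin\<X> disj V(1) finite_subset[OF shadowV] by (intro card_UN_disjoint[symmetric]) auto
  also have "fact l * real (card (\<Union>X\<in>\<X>. shadow l (L X))) \<le> fact l * real (card {T. T \<subseteq> V \<and> card T = l})"
    using V(1) shadowV by (intro mult_left_mono of_nat_mono card_mono UN_least) auto
  also have "card {T. T \<subseteq> V \<and> card T = l} = card V choose l" using V(1) by (rule n_subsets)
  also have "fact l * real (card V choose l) = real ((card V choose l) * fact l)" by simp
  also have "\<dots> \<le> real (card V ^ l)"
    using binomial_fact_pow[of "card V" l] by (simp only: of_nat_le_iff)
  finally have "(\<Sum>X\<in>\<X>. (fact r * real (g X)) powr (real l / real r)) \<le> real (card V) ^ l" by simp
  moreover have "card F \<le> (\<Sum>X\<in>\<X>. g X) + M * card V ^ (r - 1)"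
  proof -
    have "F \<subseteq> (\<Union>X\<in>\<X>. \<G> X) \<union> bad" using \<rho>A(2) by (auto simp: \<G>_def)
    then have "card F \<le> card ((\<Union>X\<in>\<X>. \<G> X) \<union> bad)" using finU finbad by (intro card_mono) auto
    also have "\<dots> \<le> card (\<Union>X\<in>\<X>. \<G> X) + card bad" by (rule card_Un_le)
    finally show ?thesis using sumg[of \<X>] cbad by simp
  qed
  moreover have "card (F - subfamily_containing F X) \<le> (\<Sum>Y\<in>\<X> - {X}. g Y) + M * card V ^ (r - 1)"
    if "X \<in> \<X>" for X
  proof -
    have "F - subfamily_containing F X \<subseteq> (\<Union>Y\<in>\<X> - {X}. \<G> Y) \<union> bad"
    proof
      fix A assume A: "A \<in> F - subfamily_containing F X"
      show "A \<in> (\<Union>Y\<in>\<X> - {X}. \<G> Y) \<union> bad"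
      proof (cases "A \<in> bad")
        case False
        then have "A \<in> F - bad" using A by simp
        moreover from \<rho>A[OF this] have "\<rho> A \<noteq> X" "\<rho> A \<in> \<X>"
          using A by (auto simp: subfamily_containing_def)
        ultimately show ?thesis by (auto simp: \<G>_def)
      qed simp
    qed
    then have "card (F - subfamily_containing F X) \<le> card ((\<Union>Y\<in>\<X> - {X}. \<G> Y) \<union> bad)"
      using finU finbad by (intro card_mono) auto
    also have "\<dots> \<le> card (\<Union>Y\<in>\<X> - {X}. \<G> Y) + card bad" by (rule card_Un_le)
    finally show ?thesis using sumg[of "\<X> - {X}"] cbad by simp
  qed
  ultimately show ?thesis by blast
qed

subsection \<open>Real estimates\<close>

text \<open>Write h = h^p h^(1-p) twice. Bounding the second factor by that of the maximum m gives
  \<sigma> \<le> h(m)^(1-p), so the p-th powers of the other terms sum to some N \<le> 1 -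
  \<sigma>^(p/(1-p)). Among these each h^p is at most N, and the same split bounds their sum by
  N^(1/p).\<close>

lemma sum_powr_except_max:
  fixes h :: "'a \<Rightarrow> real"
  assumes I: "finite I" "I \<noteq> {}" and h: "\<And>i. i \<in> I \<Longrightarrow> 0 \<le> h i" and p: "0 < p" "p < 1"
    and le1: "(\<Sum>i\<in>I. h i powr p) \<le> 1"
  shows "\<exists>m\<in>I. (\<Sum>i\<in>I - {m}. h i) \<le> (1 - (\<Sum>i\<in>I. h i) powr (p / (1 - p))) powr (1 / p)"
proof -
  have "finite (h ` I)" "h ` I \<noteq> {}" using I by auto
  then obtain m where m: "m \<in> I" "h m = Max (h ` I)" using Max_in by (metis imageE)
  then have hm: "h i \<le> h m" if "i \<in> I" for i using that I by simp
  define \<sigma> where "\<sigma> = (\<Sum>i\<in>I. h i)"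
  define N where "N = (\<Sum>i\<in>I - {m}. h i powr p)"
  have split: "x = x powr p * x powr (1 - p)" if "0 \<le> x" for x :: real
    using that p by (cases "x = 0") (simp_all flip: powr_add)
  have "\<sigma> \<le> (\<Sum>i\<in>I. h i powr p * h m powr (1 - p))"
    unfolding \<sigma>_def
  proof (rule sum_mono)
    fix i assume i: "i \<in> I"
    have "h i powr (1 - p) \<le> h m powr (1 - p)" using h hm i p by (intro powr_mono2) auto
    then show "h i \<le> h i powr p * h m powr (1 - p)"
      using split[OF h[OF i]] mult_left_mono[of "h i powr (1 - p)" "h m powr (1 - p)" "h i powr p"] by simp
  qed
  also have "\<dots> = (\<Sum>i\<in>I. h i powr p) * h m powr (1 - p)" by (simp add: sum_distrib_right)
  also have "\<dots> \<le> 1 * h m powr (1 - p)" using le1 by (intro mult_right_mono) auto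
  finally have "\<sigma> \<le> h m powr (1 - p)" by simp
  moreover have "0 \<le> \<sigma>" using h by (simp add: \<sigma>_def sum_nonneg)
  ultimately have "\<sigma> powr (p / (1 - p)) \<le> (h m powr (1 - p)) powr (p / (1 - p))"
    using p by (intro powr_mono2) auto
  also have "\<dots> = h m powr p" using p by (simp add: powr_powr)
  finally have a: "\<sigma> powr (p / (1 - p)) \<le> h m powr p" .
  have "(\<Sum>i\<in>I. h i powr p) = h m powr p + N" unfolding N_def using I(1) m(1) by (rule sum.remove)
  then have N1: "N \<le> 1 - \<sigma> powr (p / (1 - p))" using a le1 by linarith
  have N0: "0 \<le> N" by (simp add: N_def sum_nonneg)
  have "(\<Sum>i\<in>I - {m}. h i) \<le> (\<Sum>i\<in>I - {m}. h i powr p * N powr ((1 - p) / p))"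
  proof (rule sum_mono)
    fix i assume i: "i \<in> I - {m}"
    have "h i powr p \<le> N" unfolding N_def using i I by (intro member_le_sum) auto
    then have "(h i powr p) powr ((1 - p) / p) \<le> N powr ((1 - p) / p)" using p by (intro powr_mono2) auto
    then have "h i powr (1 - p) \<le> N powr ((1 - p) / p)" using p by (simp add: powr_powr)
    then show "h i \<le> h i powr p * N powr ((1 - p) / p)"
      using split[of "h i"] h i mult_left_mono[of "h i powr (1 - p)" "N powr ((1 - p) / p)" "h i powr p"] by simp
  qed
  also have "\<dots> = N * N powr ((1 - p) / p)" unfolding N_def by (rule sum_distrib_right[symmetric])
  also have "\<dots> = N powr (1 / p)"
  proof (cases "N = 0")
    case False
    then have "N * N powr ((1 - p) / p) = N powr (1 + (1 - p) / p)" using N0 by (simp add: powr_add)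
    then show ?thesis using p by (simp add: field_simps)
  qed simp
  also have "\<dots> \<le> (1 - \<sigma> powr (p / (1 - p))) powr (1 / p)" using N0 N1 p by (intro powr_mono2) auto
  finally show ?thesis using m(1) unfolding \<sigma>_def by blast
qed

text \<open>Mean value theorem, the intermediate point being at most 1 + \<eta>. The case u = 0 is
  separate because the derivative of \<open>powr\<close> is taken at positive arguments.\<close>

lemma powr_add_le:
  fixes u \<eta> e :: real
  assumes "0 \<le> u" "u \<le> 1" "0 \<le> \<eta>" "1 \<le> e"
  shows "(u + \<eta>) powr e \<le> u powr e + e * \<eta> * (1 + \<eta>) powr (e - 1)"
proof (cases "u = 0 \<or> \<eta> = 0")
  case True
  then show ?thesis
  proof (elim disjE)
    assume u: "u = 0"
    have "\<eta> powr e = \<eta> * \<eta> powr (e - 1)" using assms by (cases "\<eta> = 0") (simp_all add: powr_diff)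
    also have "\<dots> \<le> e * \<eta> * (1 + \<eta>) powr (e - 1)"
      using assms by (intro mult_mono powr_mono2) (auto simp: mult_le_cancel_right1)
    finally show ?thesis using u by simp
  qed simp
next
  case False
  then have pos: "0 < u" "0 < \<eta>" using assms by auto
  have "\<exists>z>u. z < u + \<eta> \<and> (u + \<eta>) powr e - u powr e = (u + \<eta> - u) * (e * z powr (e - 1))"
    using pos by (intro MVT2) (auto intro!: derivative_eq_intros)
  then obtain z where z: "u < z" "z < u + \<eta>" "(u + \<eta>) powr e - u powr e = \<eta> * (e * z powr (e - 1))" by auto
  have "z powr (e - 1) \<le> (1 + \<eta>) powr (e - 1)" using z pos assms by (intro powr_mono2) auto
  then have "\<eta> * (e * z powr (e - 1)) \<le> \<eta> * (e * (1 + \<eta>) powr (e - 1))"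
    using pos assms by (intro mult_left_mono) auto
  then show ?thesis using z(3) by (simp add: mult_ac)
qed

text \<open>From \<sigma>^s \<ge> 1 + s ln \<sigma> and ln \<sigma> \<ge> 1 - 1/\<sigma> the base is
  at most s\<epsilon>' / (1 - \<epsilon>') with \<epsilon>' = \<epsilon> + \<delta>. For \<epsilon>
  near 1 this cannot be compared with \<delta> = 0 uniformly, but there the trivial bound 1 takes
  over; hence the minimum and a \<open>C\<close> free of \<epsilon>.\<close>

lemma one_minus_powr_bound:
  fixes p \<epsilon> \<delta> \<sigma> :: real
  defines "s \<equiv> p / (1 - p)"
  defines "C \<equiv> (1 / p) * (2 * s / p\<^sup>2) * (1 + s / p) powr (1 / p - 1)"
  assumes p: "0 < p" "p < 1" and \<epsilon>: "0 \<le> \<epsilon>" "\<epsilon> < 1" and \<delta>: "0 \<le> \<delta>" "\<delta> \<le> p / 2"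
    and \<sigma>: "1 - \<epsilon> - \<delta> \<le> \<sigma>" "0 \<le> \<sigma>" "\<sigma> \<le> 1"
  shows "(1 - \<sigma> powr s) powr (1 / p) \<le> min 1 ((s * \<epsilon> / (1 - \<epsilon>)) powr (1 / p)) + C * \<delta>"
proof -
  have s: "0 < s" using p by (simp add: s_def)
  have C0: "0 \<le> C" unfolding C_def using p s by simp
  define u where "u = s * \<epsilon> / (1 - \<epsilon>)"
  have u0: "0 \<le> u" using s \<epsilon> by (simp add: u_def)
  have "\<sigma> powr s \<le> 1" using \<sigma> s by (intro powr_le1) auto
  show ?thesis
  proof (cases "u \<le> 1")
    case False
    have "(1 - \<sigma> powr s) powr (1 / p) \<le> 1" using \<open>\<sigma> powr s \<le> 1\<close> p by (intro powr_le1) auto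
    moreover have "1 \<le> u powr (1 / p)" using False p by (intro ge_one_powr_ge_zero) auto
    moreover have "0 \<le> C * \<delta>" using C0 \<delta>(1) by simp
    ultimately show ?thesis unfolding u_def by linarith
  next
    case True
    \<comment> \<open>The condition u \<le> 1 amounts to p \<le> 1 - \<epsilon>, which together with
      \<delta> \<le> p / 2 keeps both denominators away from 0.\<close>
    have "s * \<epsilon> \<le> 1 - \<epsilon>" using True \<epsilon> by (simp add: u_def)
    then have "p * \<epsilon> \<le> (1 - \<epsilon>) * (1 - p)" using p by (simp add: s_def field_simps)
    then have e1: "p \<le> 1 - \<epsilon>" by (simp add: algebra_simps)
    define \<epsilon>' where "\<epsilon>' = \<epsilon> + \<delta>"
    have e2: "p / 2 \<le> 1 - \<epsilon>'" using e1 \<delta> by (simp add: \<epsilon>'_def)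
    have \<sigma>': "1 - \<epsilon>' \<le> \<sigma>" using \<sigma>(1) by (simp add: \<epsilon>'_def)
    have \<sigma>0: "0 < \<sigma>" using \<sigma>' e2 p by linarith
    define \<eta> where "\<eta> = 2 * s / p\<^sup>2 * \<delta>"
    have \<eta>0: "0 \<le> \<eta>" using s \<delta> by (simp add: \<eta>_def)
    have "ln (1 / \<sigma>) \<le> 1 / \<sigma> - 1" using \<sigma>0 by (intro ln_le_minus_one) simp
    then have "1 - 1 / \<sigma> \<le> ln \<sigma>" using \<sigma>0 by (simp add: ln_div)
    moreover have "1 / \<sigma> \<le> 1 / (1 - \<epsilon>')" using \<sigma>' e2 p by (intro divide_left_mono) auto
    ultimately have "s * (1 - 1 / (1 - \<epsilon>')) \<le> s * ln \<sigma>" using s by (intro mult_left_mono) auto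
    also have "s * ln \<sigma> \<le> exp (s * ln \<sigma>) - 1" using exp_ge_add_one_self[of "s * ln \<sigma>"] by linarith
    also have "exp (s * ln \<sigma>) = \<sigma> powr s" using \<sigma>0 by (simp add: powr_def)
    finally have "1 - \<sigma> powr s \<le> s * (1 / (1 - \<epsilon>') - 1)" by (simp add: algebra_simps)
    also have "\<dots> = u + s * (1 / (1 - \<epsilon>') - 1 / (1 - \<epsilon>))"
    proof -
      have "u = s * (1 / (1 - \<epsilon>) - 1)" using \<epsilon> by (simp add: u_def field_simps)
      then show ?thesis by (simp add: right_diff_distrib)
    qed
    also have "1 / (1 - \<epsilon>') - 1 / (1 - \<epsilon>) = \<delta> / ((1 - \<epsilon>') * (1 - \<epsilon>))"
      using e1 e2 p by (simp add: \<epsilon>'_def field_simps)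
    also have "\<delta> / ((1 - \<epsilon>') * (1 - \<epsilon>)) \<le> \<delta> / (p / 2 * p)"
      using e1 e2 p \<delta> by (intro divide_left_mono mult_mono) auto
    then have "u + s * (\<delta> / ((1 - \<epsilon>') * (1 - \<epsilon>))) \<le> u + s * (\<delta> / (p / 2 * p))"
      using s by (intro add_left_mono mult_left_mono) auto
    also have "\<dots> = u + \<eta>" by (simp add: \<eta>_def power2_eq_square)
    finally have "1 - \<sigma> powr s \<le> u + \<eta>" .
    then have "(1 - \<sigma> powr s) powr (1 / p) \<le> (u + \<eta>) powr (1 / p)"
      using \<open>\<sigma> powr s \<le> 1\<close> p by (intro powr_mono2) auto
    also have "\<dots> \<le> u powr (1 / p) + 1 / p * \<eta> * (1 + \<eta>) powr (1 / p - 1)"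
      using u0 True \<eta>0 p by (intro powr_add_le) auto
    also have "\<dots> \<le> u powr (1 / p) + 1 / p * \<eta> * (1 + s / p) powr (1 / p - 1)"
    proof -
      have "\<eta> \<le> 2 * s / p\<^sup>2 * (p / 2)" unfolding \<eta>_def using s \<delta> by (intro mult_left_mono) auto
      also have "\<dots> = s / p" using p by (simp add: power2_eq_square)
      finally show ?thesis using \<eta>0 p by (intro add_left_mono mult_left_mono powr_mono2) auto
    qed
    also have "\<dots> = u powr (1 / p) + C * \<delta>" by (simp add: C_def \<eta>_def)
    also have "u powr (1 / p) = min 1 (u powr (1 / p))"
      using u0 True p powr_le1[of "1 / p" u] by simp
    finally show ?thesis by (simp only: u_def)
  qed
qed

section \<open>Binomial coefficients against powers\<close>

lemma fact_binomial_ge: "(m - r) ^ r \<le> (m choose r) * fact r"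
proof (induction r)
  case (Suc r)
  have "(m - Suc r) ^ Suc r \<le> (m - r) ^ r * (m - r)"
    using mult_mono[of "(m - Suc r) ^ r" "(m - r) ^ r" "m - Suc r" "m - r"]
    by (simp add: power_mono mult.commute)
  also have "\<dots> \<le> (m choose r) * fact r * (m - r)" using Suc by simp
  also have "\<dots> = (Suc r * (m choose Suc r)) * fact r"
    by (metis binomial_absorb_comp binomial_absorption mult.commute mult.assoc)
  finally show ?case by (simp add: algebra_simps)
qed simp

text \<open>The right side is at least (n - a - r)^r \<ge> (n - k)^r, and Bernoulli's inequality
  compares this with n^r.\<close>

lemma binomial_lower_bound:
  assumes "a + r \<le> k" "k \<le> n" "1 \<le> r"
  shows "real n ^ r - real (r * k) * real n ^ (r - 1) \<le> fact r * real ((n - a) choose r)"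
proof -
  have "real (n - k) ^ r \<le> real ((n - a - r) ^ r)"
    using assms by (simp add: power_mono)
  also have "\<dots> \<le> fact r * real ((n - a) choose r)"
    using fact_binomial_ge[of "n - a" r] by (metis mult.commute of_nat_fact of_nat_le_iff of_nat_mult)
  finally have 1: "real (n - k) ^ r \<le> fact r * real ((n - a) choose r)" .
  show ?thesis
  proof (cases "n = 0")
    case True
    then show ?thesis using assms by simp
  next
    case False
    have "1 + real r * (- (real k / real n)) \<le> (1 + - (real k / real n)) ^ r"
      using assms False by (intro Bernoulli_inequality) (simp add: field_simps)
    then have "real n ^ r * (1 - real r * (real k / real n)) \<le> real n ^ r * (1 - real k / real n) ^ r"
      by (intro mult_left_mono) auto
    also have "\<dots> = (real n * (1 - real k / real n)) ^ r" by (rule power_mult_distrib[symmetric])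
    also have "real n * (1 - real k / real n) = real (n - k)"
      using False assms by (simp add: field_simps of_nat_diff)
    finally have "real n ^ r * (1 - real r * (real k / real n)) \<le> real (n - k) ^ r" .
    moreover have "real n ^ r = real n * real n ^ (r - 1)"
      using assms(3) by (metis One_nat_def Suc_le_D diff_Suc_1 power_Suc)
    then have "real n ^ r * (1 - real r * (real k / real n)) = real n ^ r - real (r * k) * real n ^ (r - 1)"
      using False by (simp add: right_diff_distrib)
    ultimately show ?thesis using 1 by linarith
  qed
qed

subsection \<open>Stability\<close>

text \<open>The claim includes \<open>0 \<le> C\<close> so that the constants for different l can be
  added up.\<close>

lemma avoiding_stability_fixed_l:
  fixes k l :: nat
  assumes l: "1 \<le> l" and k: "2 * l + 3 \<le> k"
  shows "\<exists>(n0::nat) (C::real). 0 \<le> C \<and> (\<forall>(n::nat) (\<epsilon>::real) (F::nat set set).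
    n0 \<le> n \<longrightarrow> 0 \<le> \<epsilon> \<longrightarrow> \<epsilon> < 1 \<longrightarrow>
    F \<subseteq> [{1..n}]\<^bsup>k\<^esup> \<longrightarrow> avoids_intersection l F \<longrightarrow>
    real (card F) \<ge> (1 - \<epsilon>) * real ((n - l - 1) choose (k - l - 1)) \<longrightarrow>
    (\<exists>X \<subseteq> {1..n}. card X = l + 1 \<and>
      real (card (F - subfamily_containing F X))
        \<le> ((real l * \<epsilon>) / ((1 - \<epsilon>) * (real k - 2 * real l - 1)))
              powr ((real k - real l - 1) / real l)
            * real ((n - l - 1) choose (k - l - 1))
          + C * real n ^ (k - l - 2)))"
proof -
  define r where "r = k - l - 1"
  define p where "p = real l / real r"
  define s where "s = p / (1 - p)"
  define C2 where "C2 = (1 / p) * (2 * s / p\<^sup>2) * (1 + s / p) powr (1 / p - 1)"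
  define M where "M = k ^ k * (2 * 2 ^ k * (Suc k * k)) ^ (2 ^ k)"
  \<comment> \<open>E n^(r-1) collects the two losses in the lower bound for the sum of h:
    \<open>r * k\<close> from replacing r! times the binomial coefficient by n^r, and r! M from the
    rootless members.\<close>
  define E where "E = real (r * k) + fact r * real M"
  have r: "l + 2 \<le> r" "1 \<le> r" "l < r" using k by (auto simp: r_def)
  have p: "0 < p" "p < 1" using l r by (auto simp: p_def)
  have rl: "real k - 2 * real l - 1 = real r - real l" "real k - real l - 1 = real r"
    using k by (auto simp: r_def of_nat_diff)
  have s_eq: "s = real l / (real r - real l)" using r by (simp add: s_def p_def field_simps)
  have ip: "1 / p = real r / real l" by (simp add: p_def)
  have s0: "0 < s" using p by (simp add: s_def)
  have C20: "0 \<le> C2" using p s0 by (simp add: C2_def)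
  have E0: "0 \<le> E" by (simp add: E_def)
  \<comment> \<open>The last summand makes \<delta> = E / n at most p / 2, as
    \<open>one_minus_powr_bound\<close> demands.\<close>
  define n0 where "n0 = k + 1 + nat \<lceil>2 * E / p\<rceil>"
  define C where "C = real M + C2 * E + real (r * k)"
  show ?thesis
  proof (intro exI[of _ n0] exI[of _ C] conjI allI impI)
    show "0 \<le> C" using C20 E0 by (simp add: C_def)
    fix n :: nat and \<epsilon> :: real and F :: "nat set set"
    assume n: "n0 \<le> n" and \<epsilon>: "0 \<le> \<epsilon>" "\<epsilon> < 1" and F: "F \<subseteq> [{1..n}]\<^bsup>k\<^esup>"
      and av: "avoids_intersection l F"
      and large: "(1 - \<epsilon>) * real ((n - l - 1) choose (k - l - 1)) \<le> real (card F)"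
    have nk: "k \<le> n" "0 < n" using n by (auto simp: n0_def)
    have n1: "2 * E / p \<le> real n"
    proof -
      have "2 * E / p \<le> real (nat \<lceil>2 * E / p\<rceil>)" by (rule real_nat_ceiling_ge)
      also have "\<dots> \<le> real n" unfolding of_nat_le_iff using n unfolding n0_def by linarith
      finally show ?thesis .
    qed
    define \<X> where "\<X> = {X. X \<subseteq> {1..n} \<and> card X = l + 1}"
    have fin\<X>: "finite \<X>" by (simp add: \<X>_def)
    have "\<X> \<noteq> {}"
    proof -
      have "{1..l + 1} \<in> \<X>" using nk k by (auto simp: \<X>_def)
      then show ?thesis by blast
    qed
    have FV: "A \<subseteq> {1..n} \<and> card A = k" if "A \<in> F" for A
      using F that by (auto simp: nsets_def)
    define S where "S = r - 1"
    have Sk: "k - l - 2 = S" by (simp add: S_def r_def)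
    have nS: "real n ^ r = real n * real n ^ S" using r by (simp add: S_def flip: power_Suc)
    from root_decomposition[of "{1..n}" F, OF _ FV av k l] obtain g :: "nat set \<Rightarrow> nat"
      where g1: "(\<Sum>X\<in>\<X>. (fact r * real (g X)) powr p) \<le> real n ^ l"
      and g2: "card F \<le> (\<Sum>X\<in>\<X>. g X) + M * n ^ S"
      and g3: "\<forall>X\<in>\<X>. card (F - subfamily_containing F X) \<le> (\<Sum>Y\<in>\<X> - {X}. g Y) + M * n ^ S"
      unfolding r_def[symmetric] \<X>_def[symmetric] M_def[symmetric] p_def[symmetric] S_def[symmetric]
      by (auto simp del: of_nat_sum)
    \<comment> \<open>This scale satisfies R^p = n^l, which turns the shadow bound into the
      normalised constraint with right side 1.\<close>
    define R where "R = real n ^ r"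
    have R0: "0 < R" using nk by (simp add: R_def)
    define h where "h X = fact r * real (g X) / R" for X
    define B where "B = real ((n - l - 1) choose r)"
    have hsum: "(\<Sum>X\<in>Z. h X) = fact r * real (\<Sum>X\<in>Z. g X) / R" for Z
      by (simp add: h_def sum_distrib_left sum_divide_distrib)
    have h0: "0 \<le> h X" for X using R0 by (simp add: h_def)
    have Rp: "R powr p = real n ^ l"
      using nk r by (simp add: R_def p_def powr_powr flip: powr_realpow)
    have hp: "(\<Sum>X\<in>\<X>. h X powr p) \<le> 1"
    proof -
      have "(\<Sum>X\<in>\<X>. h X powr p) = (\<Sum>X\<in>\<X>. (fact r * real (g X)) powr p) / R powr p"
        unfolding sum_divide_distrib h_def by (intro sum.cong refl powr_divide)
      also have "\<dots> \<le> 1" using g1 Rp nk by simp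
      finally show ?thesis .
    qed
    define \<sigma> where "\<sigma> = (\<Sum>X\<in>\<X>. h X)"
    have \<sigma>0: "0 \<le> \<sigma>" using h0 by (simp add: \<sigma>_def sum_nonneg)
    have \<sigma>1: "\<sigma> \<le> 1"
    proof -
      have "h X \<le> h X powr p" if "X \<in> \<X>" for X
      proof -
        have "h X powr p \<le> (\<Sum>X\<in>\<X>. h X powr p)" using that fin\<X> by (intro member_le_sum) auto
        then have "h X powr p \<le> 1" using hp by simp
        moreover have "1 < h X powr p" if "1 < h X" using that p by (intro gr_one_powr) auto
        ultimately have "h X \<le> 1" by linarith
        then show ?thesis using h0[of X] p powr_mono'[of p 1 "h X"] by simp
      qed
      then have "\<sigma> \<le> (\<Sum>X\<in>\<X>. h X powr p)" unfolding \<sigma>_def by (intro sum_mono)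
      then show ?thesis using hp by simp
    qed
    have Bl: "R - real (r * k) * real n ^ S \<le> fact r * B"
      using binomial_lower_bound[of "l + 1" r k n] k r nk by (simp add: R_def B_def S_def r_def)
    define \<delta> where "\<delta> = E / real n"
    have \<delta>: "0 \<le> \<delta>" "\<delta> \<le> p / 2"
      using n1 E0 nk p by (auto simp: \<delta>_def field_simps)
    have nR: "real n ^ S = R / real n" using nS nk by (simp add: R_def)
    have \<sigma>l: "1 - \<epsilon> - \<delta> \<le> \<sigma>"
    proof -
      have "real (card F) \<le> real ((\<Sum>X\<in>\<X>. g X) + M * n ^ S)" using g2 by (simp only: of_nat_le_iff)
      then have "(1 - \<epsilon>) * B \<le> real (\<Sum>X\<in>\<X>. g X) + real M * real n ^ S"
        using large by (simp add: B_def r_def)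
      then have "fact r * ((1 - \<epsilon>) * B) \<le> fact r * (real (\<Sum>X\<in>\<X>. g X) + real M * real n ^ S)"
        by (intro mult_left_mono) auto
      also have "\<dots> = R * \<sigma> + fact r * real M * real n ^ S"
        using R0 by (simp add: \<sigma>_def hsum distrib_left)
      finally have 1: "(1 - \<epsilon>) * (fact r * B) \<le> R * \<sigma> + fact r * real M * real n ^ S" by (simp add: mult_ac)
      have "(1 - \<epsilon>) * R - real (r * k) * real n ^ S \<le> (1 - \<epsilon>) * (R - real (r * k) * real n ^ S)"
      proof -
        have "(1 - \<epsilon>) * (real (r * k) * real n ^ S) \<le> 1 * (real (r * k) * real n ^ S)"
          using \<epsilon> by (intro mult_right_mono) auto
        then show ?thesis by (simp only: right_diff_distrib)
      qed
      also have "\<dots> \<le> (1 - \<epsilon>) * (fact r * B)" using Bl \<epsilon> by (intro mult_left_mono) auto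
      finally have "(1 - \<epsilon>) * R \<le> R * \<sigma> + E * real n ^ S" using 1 by (simp add: E_def distrib_right)
      also have "\<dots> = R * (\<sigma> + \<delta>)" by (simp add: nR \<delta>_def distrib_left)
      finally have "1 - \<epsilon> \<le> \<sigma> + \<delta>" using R0 by (simp add: mult.commute)
      then show ?thesis by simp
    qed
    obtain X where X: "X \<in> \<X>" "(\<Sum>Y\<in>\<X> - {X}. h Y) \<le> (1 - \<sigma> powr s) powr (1 / p)"
      using sum_powr_except_max[OF fin\<X> \<open>\<X> \<noteq> {}\<close> h0 p hp] unfolding \<sigma>_def s_def by blast
    define t where "t = (s * \<epsilon> / (1 - \<epsilon>)) powr (1 / p)"
    have "(1 - \<sigma> powr s) powr (1 / p) \<le> min 1 t + C2 * \<delta>"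
      unfolding t_def C2_def s_def using p \<epsilon> \<delta> \<sigma>l \<sigma>0 \<sigma>1 by (rule one_minus_powr_bound)
    with X(2) have "(\<Sum>Y\<in>\<X> - {X}. h Y) \<le> min 1 t + C2 * \<delta>" by linarith
    then have "(\<Sum>Y\<in>\<X> - {X}. h Y) * R \<le> (min 1 t + C2 * \<delta>) * R" using R0 by (intro mult_right_mono) auto
    then have "fact r * real (\<Sum>Y\<in>\<X> - {X}. g Y) \<le> min 1 t * R + C2 * E * real n ^ S"
      using R0 by (simp add: hsum \<delta>_def nR distrib_right)
    \<comment> \<open>Here n^r is exchanged for the binomial coefficient. As t is unbounded for
      \<epsilon> near 1, the minimum is kept until the error term has been separated, where it is
      bounded by 1.\<close>
    also have "min 1 t * R \<le> min 1 t * (fact r * B + real (r * k) * real n ^ S)"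
      using Bl by (intro mult_left_mono) (auto simp: t_def)
    also have "\<dots> = min 1 t * (fact r * B) + min 1 t * (real (r * k) * real n ^ S)" by (rule distrib_left)
    also have "\<dots> \<le> t * (fact r * B) + 1 * (real (r * k) * real n ^ S)"
      by (intro add_mono mult_right_mono) (auto simp: B_def)
    finally have 2: "fact r * real (\<Sum>Y\<in>\<X> - {X}. g Y) \<le> fact r * (t * B) + (real (r * k) + C2 * E) * real n ^ S"
      by (simp add: algebra_simps)
    have f1: "1 \<le> (fact r :: real)" by (rule fact_ge_1)
    have "(real (r * k) + C2 * E) * real n ^ S \<le> fact r * ((real (r * k) + C2 * E) * real n ^ S)"
      using mult_right_mono[OF f1, of "(real (r * k) + C2 * E) * real n ^ S"] C20 E0 by simp
    with 2 have "fact r * real (\<Sum>Y\<in>\<X> - {X}. g Y) \<le> fact r * (t * B + (real (r * k) + C2 * E) * real n ^ S)"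
      by (simp add: distrib_left)
    then have 3: "real (\<Sum>Y\<in>\<X> - {X}. g Y) \<le> t * B + (real (r * k) + C2 * E) * real n ^ S"
      by (simp only: mult_le_cancel_left_pos[OF fact_gt_zero])
    have "card (F - subfamily_containing F X) \<le> (\<Sum>Y\<in>\<X> - {X}. g Y) + M * n ^ S" using g3 X(1) by blast
    then have "real (card (F - subfamily_containing F X)) \<le> real ((\<Sum>Y\<in>\<X> - {X}. g Y) + M * n ^ S)"
      by (simp only: of_nat_le_iff)
    also have "\<dots> \<le> t * B + C * real n ^ S" using 3 by (simp add: C_def algebra_simps)
    finally have 4: "real (card (F - subfamily_containing F X)) \<le> t * B + C * real n ^ S" .
    have "t = (real l * \<epsilon> / ((1 - \<epsilon>) * (real k - 2 * real l - 1))) powr ((real k - real l - 1) / real l)"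
      unfolding t_def rl ip s_eq by (simp add: mult.commute)
    with 4 X(1) show "\<exists>X \<subseteq> {1..n}. card X = l + 1 \<and>
      real (card (F - subfamily_containing F X))
        \<le> ((real l * \<epsilon>) / ((1 - \<epsilon>) * (real k - 2 * real l - 1)))
              powr ((real k - real l - 1) / real l)
            * real ((n - l - 1) choose (k - l - 1))
          + C * real n ^ (k - l - 2)"
      unfolding Sk B_def r_def[symmetric] \<X>_def by blast
  qed
qed

theorem theorem51:
  fixes k :: nat
  shows "\<exists>(n0::nat) (C::real). \<forall>(l::nat) (n::nat) (\<epsilon>::real) (F::nat set set).
    1 \<le> l \<longrightarrow> 2 * l + 3 \<le> k \<longrightarrow> n0 \<le> n \<longrightarrow> 0 \<le> \<epsilon> \<longrightarrow> \<epsilon> < 1 \<longrightarrow>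
    F \<subseteq> [{1..n}]\<^bsup>k\<^esup> \<longrightarrow> avoids_intersection l F \<longrightarrow>
    real (card F) \<ge> (1 - \<epsilon>) * real ((n - l - 1) choose (k - l - 1)) \<longrightarrow>
    (\<exists>X \<subseteq> {1..n}. card X = l + 1 \<and>
      real (card (F - subfamily_containing F X))
        \<le> ((real l * \<epsilon>) / ((1 - \<epsilon>) * (real k - 2 * real l - 1)))
              powr ((real k - real l - 1) / real l)
            * real ((n - l - 1) choose (k - l - 1))
          + C * real n ^ (k - l - 2))"
proof -
  define P where "P l n0 C \<longleftrightarrow> 0 \<le> C \<and> (\<forall>(n::nat) (\<epsilon>::real) (F::nat set set).
    n0 \<le> n \<longrightarrow> 0 \<le> \<epsilon> \<longrightarrow> \<epsilon> < 1 \<longrightarrow>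
    F \<subseteq> [{1..n}]\<^bsup>k\<^esup> \<longrightarrow> avoids_intersection l F \<longrightarrow>
    real (card F) \<ge> (1 - \<epsilon>) * real ((n - l - 1) choose (k - l - 1)) \<longrightarrow>
    (\<exists>X \<subseteq> {1..n}. card X = l + 1 \<and>
      real (card (F - subfamily_containing F X))
        \<le> ((real l * \<epsilon>) / ((1 - \<epsilon>) * (real k - 2 * real l - 1)))
              powr ((real k - real l - 1) / real l)
            * real ((n - l - 1) choose (k - l - 1))
          + C * real n ^ (k - l - 2)))" for l n0 :: nat and C :: real
  \<comment> \<open>Only finitely many l fit a given k, so the thresholds and constants can be made
    independent of l. Sums of nonnegative terms dominate each term and, unlike maxima, cover an
    empty \<open>L\<close>.\<close>
  define L where "L = {l. 1 \<le> l \<and> 2 * l + 3 \<le> k}"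
  have finL: "finite L" by (rule finite_subset[of _ "{..k}"]) (auto simp: L_def)
  have "\<forall>l\<in>L. \<exists>n0 C. P l n0 C" unfolding P_def L_def using avoiding_stability_fixed_l by simp
  then obtain n0 C where nC: "\<And>l. l \<in> L \<Longrightarrow> P l (n0 l) (C l)" by metis
  show ?thesis
  proof (intro exI[of _ "sum n0 L"] exI[of _ "sum C L"] allI impI)
    fix l n :: nat and \<epsilon> :: real and F :: "nat set set"
    assume l: "1 \<le> l" "2 * l + 3 \<le> k" and n: "sum n0 L \<le> n" and rest: "0 \<le> \<epsilon>" "\<epsilon> < 1"
      "F \<subseteq> [{1..n}]\<^bsup>k\<^esup>" "avoids_intersection l F"
      "(1 - \<epsilon>) * real ((n - l - 1) choose (k - l - 1)) \<le> real (card F)"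
    have lL: "l \<in> L" using l by (simp add: L_def)
    have "n0 l \<le> sum n0 L" using lL finL by (intro member_le_sum) auto
    then have "n0 l \<le> n" using n by simp
    then obtain X where X: "X \<subseteq> {1..n}" "card X = l + 1"
      "real (card (F - subfamily_containing F X))
        \<le> ((real l * \<epsilon>) / ((1 - \<epsilon>) * (real k - 2 * real l - 1)))
              powr ((real k - real l - 1) / real l)
            * real ((n - l - 1) choose (k - l - 1))
          + C l * real n ^ (k - l - 2)"
      using nC[OF lL] rest unfolding P_def by blast
    have "0 \<le> C l'" if "l' \<in> L" for l' using nC[OF that] by (simp add: P_def)
    then have "C l \<le> sum C L" using lL finL by (intro member_le_sum) auto
    then have "C l * real n ^ (k - l - 2) \<le> sum C L * real n ^ (k - l - 2)" by (intro mult_right_mono) auto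
    with X show "\<exists>X \<subseteq> {1..n}. card X = l + 1 \<and>
      real (card (F - subfamily_containing F X))
        \<le> ((real l * \<epsilon>) / ((1 - \<epsilon>) * (real k - 2 * real l - 1)))
              powr ((real k - real l - 1) / real l)
            * real ((n - l - 1) choose (k - l - 1))
          + sum C L * real n ^ (k - l - 2)"
      by (intro exI[of _ X]) auto
  qed
qed

end
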